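(* Let $0\leq\alpha\leq\rho$, $\rho>0$, $0<\gamma<\sigma\leq 1$, $\delta\in\{-1,1\}$, $p<0$ and $\frac1p+\frac1q=1$. Suppose there exists $n_0\in\mathbf N$ such that $\nu_n\geq\nu_{n+1}$ for all $n\in\{n_0,n_0+1,\dots\}$, and $U(\infty)=V(\infty)=\infty$. Then for all functions $f\ge 0$ on $\mathbf R_+$ and all sequences $a=\{a_n\}_{n=1}^\infty$, $a_n\ge0$, with $0<\|f\|_{p,\Phi_\delta}<\infty$ and $0<\|a\|_{q,\widetilde\Psi}<\infty$, the following equivalent inequalities hold: $$\sum_{n=1}^{\infty}\int_0^\infty H_\delta(x,n)\,a_nf(x)\,dx>k(\sigma)\|f\|_{p,\Phi_\delta}\|a\|_{q,\widetilde\Psi},$$ $$\left\{\sum_{n=1}^\infty\frac{\nu_n}{\widetilde V_n^{1-p\sigma}}\left[\int_0^\infty H_\delta(x,n)f(x)\,dx\right]^p\right\}^{\frac1p}>k(\sigma)\|f\|_{p,\Phi_\delta},$$ $$\left\{\int_0^\infty\frac{\mu(x)}{U^{1-q\delta\sigma}(x)}\left[\sum_{n=1}^\infty H_\delta(x,n)a_n\right]^q dx\right\}^{\frac1q}>k(\sigma)\|a\|_{q,\widetilde\Psi}.$$ Moreover the constant factor $k(\sigma)$ is the best possible in each of them, i.e. it cannot be replaced by any larger constant so that the inequality remains valid for all such $f$ and $a$.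
   Context: $\mathbf{N}=\{1,2,\dots\}$, $\mathbf{R}_+=(0,\infty)$. $\nu_n>0$ ($n\in\mathbf N$) are given reals, $V_n:=\sum_{j=1}^n\nu_j$, $\widetilde\nu_n\in[0,\frac{\nu_n}{2}]$, $\widetilde V_n:=V_n-\widetilde\nu_n$. $\mu$ is a positive continuous function on $\mathbf R_+$ with $U(x):=\int_0^x\mu(t)\,dt<\infty$ for $x\in[0,\infty)$, and $U(\infty):=\int_0^\infty\mu(t)\,dt$. $\nu(t):=\nu_n$ for $t\in(n-\frac12,n+\frac12]$, $V(y):=\int_{1/2}^y\nu(t)\,dt$ for $y\ge\frac12$, and $V(\infty):=\lim_{y\to\infty}V(y)=\sum_{n=1}^\infty\nu_n$. Powers such as $U^{s}(x)$ mean $(U(x))^{s}$. Functions are assumed measurable. $\operatorname{csch}(u):=\frac{2}{e^u-e^{-u}}$ for $u>0$. The kernel is $$H_\delta(x,n):=\frac{\operatorname{csch}\big(\rho(U^\delta(x)\widetilde V_n)^\gamma\big)}{e^{\alpha(U^\delta(x)\widetilde V_n)^\gamma}}.$$ $\Phi_\delta(x):=\frac{U^{p(1-\delta\sigma)-1}(x)}{\mu^{p-1}(x)}$, $\widetilde\Psi(n):=\frac{\widetilde V_n^{q(1-\sigma)-1}}{\nu_n^{q-1}}$; the formal symbols $\|f\|_{p,\Phi_\delta}:=\left(\int_0^\infty\Phi_\delta(x)f^p(x)\,dx\right)^{1/p}$, $\|a\|_{q,\widetilde\Psi}:=\left(\sum_{n=1}^\infty\widetilde\Psi(n)a_n^q\right)^{1/q}$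 are used also for exponents less than $1$ (they are then not norms), with the extended-real conventions $0^r=\infty$, $\infty^r=0$ for $r<0$. $$k(\sigma):=\int_0^\infty\frac{\operatorname{csch}(\rho t^\gamma)}{e^{\alpha t^\gamma}}t^{\sigma-1}dt=\frac{2\Gamma(\frac\sigma\gamma)}{\gamma(2\rho)^{\sigma/\gamma}}\zeta\Big(\frac\sigma\gamma,\frac{\alpha+\rho}{2\rho}\Big),$$ where $\zeta(s,a):=\sum_{k=0}^\infty\frac1{(k+a)^s}$ ($s>1$, $0<a\le1$) is the Hurwitz zeta function and $\Gamma$ is the Gamma function. *)

theory Defs
  imports "HOL-Analysis.Analysis"
begin

text \<open>
  Sequences are indexed by $1, 2, \dots$: only the values of a \<open>nat \<Rightarrow> real\<close> at positive
  arguments matter, and series over them are written with \<open>Suc n\<close>.  Likewise only the values of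
  \<open>\<mu>\<close> and \<open>f\<close> on \<open>{0<..}\<close> matter.  The exponent $\delta \in \{-1, 1\}$ is a real number, so that
  $U^\delta$ is a \<open>powr\<close>.
\<close>

text \<open>
  Real powers of extended nonnegative numbers, with $0^r = \infty$ and $\infty^r = 0$ for $r < 0$;
  note that \<open>0 powr r = 0\<close> for every real \<open>r\<close>, so \<open>powr\<close> is only used below on positive bases.
\<close>

definition epowr :: "ennreal \<Rightarrow> real \<Rightarrow> ennreal" (infixr "epowr" 80) where
  "x epowr r =
     (if r = 0 then 1
      else if x = 0 then (if r > 0 then 0 else \<infinity>)
      else if x = \<infinity> then (if r > 0 then \<infinity> else 0)
      else ennreal (enn2real x powr r))"

definition csch :: "real \<Rightarrow> real" where
  "csch u = 2 / (exp u - exp (- u))"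

definition partial_sum :: "(nat \<Rightarrow> real) \<Rightarrow> nat \<Rightarrow> real" where
  "partial_sum \<nu> n = (\<Sum>j=1..n. \<nu> j)"

definition V_tilde :: "(nat \<Rightarrow> real) \<Rightarrow> (nat \<Rightarrow> real) \<Rightarrow> nat \<Rightarrow> real" where
  "V_tilde \<nu> \<nu>t n = partial_sum \<nu> n - \<nu>t n"

definition U_fun :: "(real \<Rightarrow> real) \<Rightarrow> real \<Rightarrow> real" where
  "U_fun \<mu> x = (LINT t:{0<..<x}|lebesgue. \<mu> t)"

definition U_infty :: "(real \<Rightarrow> real) \<Rightarrow> ennreal" where
  "U_infty \<mu> = (\<integral>\<^sup>+t\<in>{0<..}. ennreal (\<mu> t) \<partial>lebesgue)"

definition V_infty :: "(nat \<Rightarrow> real) \<Rightarrow> ennreal" where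
  "V_infty \<nu> = (\<Sum>n. ennreal (\<nu> (Suc n)))"

definition H_kernel ::
    "real \<Rightarrow> real \<Rightarrow> real \<Rightarrow> real \<Rightarrow> (real \<Rightarrow> real) \<Rightarrow> (nat \<Rightarrow> real) \<Rightarrow> (nat \<Rightarrow> real) \<Rightarrow> real \<Rightarrow> nat \<Rightarrow> real"
  where
  "H_kernel \<alpha> \<rho> \<gamma> \<delta> \<mu> \<nu> \<nu>t x n =
     csch (\<rho> * (U_fun \<mu> x powr \<delta> * V_tilde \<nu> \<nu>t n) powr \<gamma>)
       / exp (\<alpha> * (U_fun \<mu> x powr \<delta> * V_tilde \<nu> \<nu>t n) powr \<gamma>)"

definition k_const :: "real \<Rightarrow> real \<Rightarrow> real \<Rightarrow> real \<Rightarrow> ennreal" where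
  "k_const \<alpha> \<rho> \<gamma> \<sigma> =
     (\<integral>\<^sup>+t\<in>{0<..}. ennreal (csch (\<rho> * t powr \<gamma>) / exp (\<alpha> * t powr \<gamma>) * t powr (\<sigma> - 1)) \<partial>lebesgue)"

definition Phi :: "real \<Rightarrow> real \<Rightarrow> real \<Rightarrow> (real \<Rightarrow> real) \<Rightarrow> real \<Rightarrow> real" where
  "Phi p \<delta> \<sigma> \<mu> x = U_fun \<mu> x powr (p * (1 - \<delta> * \<sigma>) - 1) / \<mu> x powr (p - 1)"

definition Psi_tilde :: "real \<Rightarrow> real \<Rightarrow> (nat \<Rightarrow> real) \<Rightarrow> (nat \<Rightarrow> real) \<Rightarrow> nat \<Rightarrow> real" where
  "Psi_tilde q \<sigma> \<nu> \<nu>t n = V_tilde \<nu> \<nu>t n powr (q * (1 - \<sigma>) - 1) / \<nu> n powr (q - 1)"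

definition norm_f :: "real \<Rightarrow> real \<Rightarrow> real \<Rightarrow> (real \<Rightarrow> real) \<Rightarrow> (real \<Rightarrow> real) \<Rightarrow> ennreal" where
  "norm_f p \<delta> \<sigma> \<mu> f =
     (\<integral>\<^sup>+x\<in>{0<..}. ennreal (Phi p \<delta> \<sigma> \<mu> x) * (ennreal (f x) epowr p) \<partial>lebesgue) epowr (1 / p)"

definition norm_a :: "real \<Rightarrow> real \<Rightarrow> (nat \<Rightarrow> real) \<Rightarrow> (nat \<Rightarrow> real) \<Rightarrow> (nat \<Rightarrow> real) \<Rightarrow> ennreal" where
  "norm_a q \<sigma> \<nu> \<nu>t a =
     (\<Sum>n. ennreal (Psi_tilde q \<sigma> \<nu> \<nu>t (Suc n)) * (ennreal (a (Suc n)) epowr q)) epowr (1 / q)"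

definition admissible_f :: "real \<Rightarrow> real \<Rightarrow> real \<Rightarrow> (real \<Rightarrow> real) \<Rightarrow> (real \<Rightarrow> real) \<Rightarrow> bool" where
  "admissible_f p \<delta> \<sigma> \<mu> f \<longleftrightarrow>
     f \<in> borel_measurable (lebesgue_on {0<..}) \<and> (\<forall>x>0. f x \<ge> 0) \<and>
     0 < norm_f p \<delta> \<sigma> \<mu> f \<and> norm_f p \<delta> \<sigma> \<mu> f < \<infinity>"

definition admissible_a ::
    "real \<Rightarrow> real \<Rightarrow> (nat \<Rightarrow> real) \<Rightarrow> (nat \<Rightarrow> real) \<Rightarrow> (nat \<Rightarrow> real) \<Rightarrow> bool" where
  "admissible_a q \<sigma> \<nu> \<nu>t a \<longleftrightarrow>
     (\<forall>n\<ge>1. a n \<ge> 0) \<and> 0 < norm_a q \<sigma> \<nu> \<nu>t a \<and> norm_a q \<sigma> \<nu> \<nu>t a < \<infinity>"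

text \<open>
  The three inequalities with an arbitrary constant \<open>C\<close> in place of $k(\sigma)$, each asserted for
  all admissible values of those of \<open>f\<close> and \<open>a\<close> that occur in it.
\<close>

definition ineq_double ::
    "real \<Rightarrow> real \<Rightarrow> real \<Rightarrow> real \<Rightarrow> real \<Rightarrow> real \<Rightarrow> real \<Rightarrow> (real \<Rightarrow> real) \<Rightarrow> (nat \<Rightarrow> real) \<Rightarrow> (nat \<Rightarrow> real)
      \<Rightarrow> ennreal \<Rightarrow> bool" where
  "ineq_double \<alpha> \<rho> \<gamma> \<sigma> \<delta> p q \<mu> \<nu> \<nu>t C \<longleftrightarrow>
     (\<forall>f a. admissible_f p \<delta> \<sigma> \<mu> f \<longrightarrow> admissible_a q \<sigma> \<nu> \<nu>t a \<longrightarrow>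
        (\<Sum>n. \<integral>\<^sup>+x\<in>{0<..}. ennreal (H_kernel \<alpha> \<rho> \<gamma> \<delta> \<mu> \<nu> \<nu>t x (Suc n) * a (Suc n) * f x) \<partial>lebesgue)
          > C * norm_f p \<delta> \<sigma> \<mu> f * norm_a q \<sigma> \<nu> \<nu>t a)"

definition ineq_series ::
    "real \<Rightarrow> real \<Rightarrow> real \<Rightarrow> real \<Rightarrow> real \<Rightarrow> real \<Rightarrow> (real \<Rightarrow> real) \<Rightarrow> (nat \<Rightarrow> real) \<Rightarrow> (nat \<Rightarrow> real)
      \<Rightarrow> ennreal \<Rightarrow> bool" where
  "ineq_series \<alpha> \<rho> \<gamma> \<sigma> \<delta> p \<mu> \<nu> \<nu>t C \<longleftrightarrow>
     (\<forall>f. admissible_f p \<delta> \<sigma> \<mu> f \<longrightarrow>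
        (\<Sum>n. ennreal (\<nu> (Suc n) / V_tilde \<nu> \<nu>t (Suc n) powr (1 - p * \<sigma>))
            * ((\<integral>\<^sup>+x\<in>{0<..}. ennreal (H_kernel \<alpha> \<rho> \<gamma> \<delta> \<mu> \<nu> \<nu>t x (Suc n) * f x) \<partial>lebesgue) epowr p))
          epowr (1 / p)
          > C * norm_f p \<delta> \<sigma> \<mu> f)"

definition ineq_integral ::
    "real \<Rightarrow> real \<Rightarrow> real \<Rightarrow> real \<Rightarrow> real \<Rightarrow> real \<Rightarrow> (real \<Rightarrow> real) \<Rightarrow> (nat \<Rightarrow> real) \<Rightarrow> (nat \<Rightarrow> real)
      \<Rightarrow> ennreal \<Rightarrow> bool" where
  "ineq_integral \<alpha> \<rho> \<gamma> \<sigma> \<delta> q \<mu> \<nu> \<nu>t C \<longleftrightarrow>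
     (\<forall>a. admissible_a q \<sigma> \<nu> \<nu>t a \<longrightarrow>
        (\<integral>\<^sup>+x\<in>{0<..}. ennreal (\<mu> x / U_fun \<mu> x powr (1 - q * \<delta> * \<sigma>))
            * ((\<Sum>n. ennreal (H_kernel \<alpha> \<rho> \<gamma> \<delta> \<mu> \<nu> \<nu>t x (Suc n) * a (Suc n))) epowr q) \<partial>lebesgue)
          epowr (1 / q)
          > C * norm_a q \<sigma> \<nu> \<nu>t a)"

end

theory Submission
  imports Defs
begin

text \<open>
  Put \<open>K(t) = csch(\<rho> t\<^sup>\<gamma>) exp(-\<alpha> t\<^sup>\<gamma>)\<close>, so that \<open>H(x, n) = K(U(x)\<^sup>\<delta> W\<^sub>n)\<close> with \<open>W\<^sub>n\<close> the reduced partial sum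
  \<open>V_tilde\<close>, and \<open>k(s)\<close> is the moment \<open>\<integral> K(t) t\<^sup>s\<^sup>-\<^sup>1 dt\<close>.  Two weights govern everything.

  \<^item> Integrating in \<open>x\<close>: since \<open>U\<close> maps the half-line onto itself, the substitution \<open>t = W\<^sub>n U(x)\<^sup>\<delta>\<close>
    evaluates \<open>\<integral> H(x, n) \<mu>(x) U(x)\<^sup>\<delta>\<^sup>s\<^sup>-\<^sup>1 dx\<close> \<^emph>\<open>exactly\<close> as \<open>k(s)\<close> divided by the power \<open>s\<close> of \<open>W\<^sub>n\<close>
    (\<open>weight_n\<close>).
  \<^item> Summing in \<open>n\<close>: the function \<open>h(v) = K(v) v\<^sup>\<sigma>\<^sup>-\<^sup>1\<close> is decreasing and strictly midpoint convex, and
    \<open>W\<^sub>n\<close> does not lie to the left of the midpoint of the cell from \<open>V\<^sub>n\<^sub>-\<^sub>1\<close> to \<open>V\<^sub>n\<close>, which has length \<open>\<nu>\<^sub>n\<close>.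
    Hence \<open>\<nu>\<^sub>n h(u W\<^sub>n)\<close> is smaller than the integral of \<open>h(u v)\<close> over that cell, and the sum is
    \<^emph>\<open>strictly\<close> below the full integral, which is \<open>k(\<sigma>)\<close> up to a power of \<open>u\<close> (\<open>weight_x\<close>).

  As \<open>p < 0\<close> and \<open>0 < q < 1\<close>, Hoelder's inequality is reversed (\<open>reverse_hoelder\<close>), and so are its
  consequences of Jensen type.  Applied to the inner integral or to the inner sum with the weights
  above, followed by an exchange of sum and integral, they give the series inequality and the
  integral inequality with the constant \<open>k(\<sigma>)\<close>; strictness comes from the strict weight
  bound, which enters with one of the negative exponents \<open>1/p\<close> and \<open>q - 1\<close>.  One more reverse Hoelder step turns either
  of these two inequalities, for \<^emph>\<open>any\<close> constant, into the double one (\<open>double_of_series\<close>,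
  \<open>double_of_integral\<close>).

  Optimality therefore has to be shown for the double inequality only (\<open>not_ineq_double\<close>).
  For small \<open>e > 0\<close> it is tested with powers of \<open>U\<close> and \<open>W\<^sub>n\<close> that are perturbed by \<open>e\<close>, for which
  the series in \<open>a\<close> is \<open>S(e) = \<Sum> \<nu>\<^sub>n W\<^sub>n\<^sup>-\<^sup>1\<^sup>-\<^sup>e\<close>.  Here \<open>e S(e)\<close> stays above a quantity tending to 1 because
  \<open>\<nu>\<close> is eventually decreasing and has a divergent sum (\<open>test_sum_ge\<close>), the norm of the test
  function is estimated by the same substitution, and the double series is at most
  \<open>k(\<sigma> + e/p) S(e) + O(1)\<close>.  Dividing by \<open>S(e)\<close> and letting \<open>e\<close> tend to 0 bounds the constant by \<open>k(\<sigma>)\<close>.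

  The three inequalities thus hold for exactly the same constants, namely those up to \<open>k(\<sigma>)\<close>,
  which is their equivalence.
\<close>

section \<open>Extended real powers\<close>

lemma epowr_ennreal: "x > 0 \<Longrightarrow> ennreal x epowr r = ennreal (x powr r)"
  by (auto simp: epowr_def)

lemma epowr_zero: "r > 0 \<Longrightarrow> 0 epowr r = 0" "r < 0 \<Longrightarrow> 0 epowr r = top"
  by (auto simp: epowr_def)

lemma epowr_top: "r > 0 \<Longrightarrow> top epowr r = top" "r < 0 \<Longrightarrow> top epowr r = 0"
  by (auto simp: epowr_def)

lemma ennreal_cases_pos:
  obtains (zero) "x = 0" | (pos) r where "r > 0" "x = ennreal r" | (inf) "x = \<infinity>"
proof (cases x)
  case (real r)
  then show ?thesis using that by (cases "r = 0") auto
qed (use that in auto)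

lemma epowr_one_left: "1 epowr r = 1"
  using epowr_ennreal[of 1 r] by simp

lemma epowr_one: "x epowr 1 = x"
  by (cases x rule: ennreal_cases_pos) (auto simp: epowr_def)

lemma epowr_epowr: "(x epowr r) epowr s = x epowr (r * s)"
proof (cases "r = 0 \<or> s = 0")
  case True
  then show ?thesis by (auto simp: epowr_def)
next
  case False
  show ?thesis
  proof (cases x rule: ennreal_cases_pos)
    case (pos a)
    then show ?thesis by (simp add: epowr_ennreal powr_powr)
  qed (use False in \<open>auto simp: epowr_def mult_pos_neg mult_neg_pos mult_less_0_iff zero_less_mult_iff not_less\<close>)
qed

lemma epowr_cmult: "c > 0 \<Longrightarrow> (ennreal c * x) epowr r = ennreal (c powr r) * x epowr r"
proof (cases x rule: ennreal_cases_pos)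
  case (pos a)
  moreover assume "c > 0"
  ultimately show ?thesis by (simp add: epowr_ennreal powr_mult flip: ennreal_mult')
qed (auto simp: epowr_def ennreal_mult_top ennreal_mult_eq_top_iff)

lemma epowr_strict_mono: 
  assumes "r > 0" "x < y" shows "x epowr r < y epowr r"
proof (cases x rule: ennreal_cases_pos; cases y rule: ennreal_cases_pos)
  fix a b assume *: "0 < a" "x = ennreal a" "0 < b" "y = ennreal b"
  then have "a < b" using assms by (simp add: ennreal_less_iff)
  then show ?thesis using * assms by (simp add: epowr_ennreal ennreal_less_iff powr_less_mono2)
qed (use assms in \<open>auto simp: epowr_def\<close>)

text \<open>
  Strictness survives at the ends of the range: for negative \<open>r\<close> the values 0 and \<open>\<infinity>\<close> are exchanged
  and every positive finite base has a positive finite power.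
\<close>

lemma epowr_strict_antimono: 
  assumes "r < 0" "x < y" shows "y epowr r < x epowr r"
proof (cases x rule: ennreal_cases_pos; cases y rule: ennreal_cases_pos)
  fix a b assume *: "0 < a" "x = ennreal a" "0 < b" "y = ennreal b"
  then have "a < b" using assms by (simp add: ennreal_less_iff)
  then show ?thesis using * assms by (simp add: epowr_ennreal ennreal_less_iff powr_less_mono2_neg)
qed (use assms in \<open>auto simp: epowr_def\<close>)

lemma epowr_mono: "r > 0 \<Longrightarrow> x \<le> y \<Longrightarrow> x epowr r \<le> y epowr r"
  using epowr_strict_mono[of r x y] by (auto simp: le_less)

lemma epowr_antimono: "r < 0 \<Longrightarrow> x \<le> y \<Longrightarrow> y epowr r \<le> x epowr r"
  using epowr_strict_antimono[of r x y] by (auto simp: le_less)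

lemma epowr_pos_finite_iff:
  assumes "r \<noteq> 0"
  shows "0 < x epowr r \<and> x epowr r < \<infinity> \<longleftrightarrow> 0 < x \<and> x < \<infinity>"
  by (cases x rule: ennreal_cases_pos) (use assms in \<open>auto simp: epowr_def\<close>)

lemma borel_measurable_epowr [measurable (raw)]:
  assumes [measurable]: "f \<in> borel_measurable M"
  shows "(\<lambda>x. f x epowr r) \<in> borel_measurable M"
  unfolding epowr_def by measurable

lemma epowr_cmult_root:
  assumes "c > 0" "r \<noteq> 0"
  shows "(ennreal (c powr (1 / r)) * x) epowr r = ennreal c * x epowr r"
  using assms by (subst epowr_cmult) (auto simp: powr_powr)

lemma epowr_root:
  assumes "c > 0" "r \<noteq> 0"
  shows "ennreal (c powr (1 / r)) epowr r = ennreal c"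
  using epowr_cmult_root[OF assms, of 1] by (simp add: epowr_one_left)

lemma epowr_eq_0_iff: "r < 0 \<Longrightarrow> x epowr r = 0 \<longleftrightarrow> x = top"
  by (cases x rule: ennreal_cases_pos) (auto simp: epowr_def)

section \<open>Hoelder and Jensen inequalities for negative and fractional exponents\<close>

lemma conjugate_exponent:
  fixes p q :: real
  assumes "p < 0" "1 / p + 1 / q = 1"
  shows "0 < q" "q < 1" "p + q = p * q" "p / q = p - 1" "q / p = q - 1"
proof -
  have *: "1 / q = 1 - 1 / p" using assms by simp
  then have "1 / q > 1" using assms(1) by simp
  then show q: "0 < q" "q < 1" by (auto simp: less_divide_eq_1)
  show pq: "p + q = p * q" using * assms(1) q by (simp add: field_simps)
  show "p / q = p - 1" "q / p = q - 1" using pq q assms(1) by (auto simp: field_simps)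
qed

text \<open>
  Weighted arithmetic--geometric mean applied to \<open>X Y\<close> and \<open>X\<^sup>p\<close>: their geometric mean with weights \<open>q\<close>
  and \<open>1 - q\<close> is \<open>Y\<^sup>q\<close>, since \<open>q + p (1 - q) = 0\<close>.  In this additive form the estimate survives all
  the degenerate cases in which \<open>X\<close> or \<open>Y\<close> is 0 or \<open>\<infinity>\<close>, where the product form would meet \<open>0 * \<infinity>\<close>.
\<close>

lemma young_negative_exponent:
  fixes X Y :: ennreal
  assumes p: "p < 0" and pq: "1 / p + 1 / q = 1"
  shows "Y epowr q \<le> ennreal q * (X * Y) + ennreal (1 - q) * X epowr p"
proof -
  note conj = conjugate_exponent[OF p pq]
  then have q: "0 < q" "q < 1" "q + p * (1 - q) = 0" by (auto simp: algebra_simps)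
  show ?thesis
  proof (cases X rule: ennreal_cases_pos; cases Y rule: ennreal_cases_pos)
    fix x y assume *: "0 < x" "X = ennreal x" "0 < y" "Y = ennreal y"
    have "(x * y) powr q * (x powr p) powr (1 - q) = y powr q * x powr (q + p * (1 - q))"
      using * by (simp add: powr_mult powr_powr powr_add)
    also have "\<dots> = y powr q" using q * by simp
    finally have "y powr q \<le> q * (x * y) + (1 - q) * x powr p"
      using Youngs_inequality_0[of q "1 - q" "x * y" "x powr p"] * q by simp
    then show ?thesis using * q
      by (simp add: epowr_ennreal flip: ennreal_mult' ennreal_plus)
  qed (use p q in \<open>auto simp: epowr_def ennreal_mult_top ennreal_top_mult ennreal_mult_eq_top_iff\<close>)
qed

text \<open>
  Integrating Young's inequality with \<open>X\<close> replaced by \<open>s X\<close> bounds \<open>\<integral> Y\<^sup>q\<close> by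
  \<open>q s A + (1 - q) s\<^sup>p B\<close> for every \<open>s > 0\<close>, where \<open>A = \<integral> X Y\<close> and \<open>B = \<integral> X\<^sup>p\<close>.  The best \<open>s\<close> balances
  the two terms, \<open>s A = s\<^sup>p B\<close>; if \<open>A\<close> or \<open>B\<close> vanishes, letting \<open>s\<close> grow or shrink
  makes the right-hand side arbitrarily small instead.
\<close>

theorem reverse_hoelder:
  fixes X Y :: "'a \<Rightarrow> ennreal"
  assumes [measurable]: "X \<in> borel_measurable M" "Y \<in> borel_measurable M"
    and p: "p < 0" and pq: "1 / p + 1 / q = 1"
  shows "(\<integral>\<^sup>+x. X x epowr p \<partial>M) epowr (1 / p) * (\<integral>\<^sup>+x. Y x epowr q \<partial>M) epowr (1 / q)
    \<le> (\<integral>\<^sup>+x. X x * Y x \<partial>M)"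
proof -
  define A where "A = (\<integral>\<^sup>+x. X x * Y x \<partial>M)"
  define B where "B = (\<integral>\<^sup>+x. X x epowr p \<partial>M)"
  define C where "C = (\<integral>\<^sup>+x. Y x epowr q \<partial>M)"
  note q = conjugate_exponent[OF p pq]
  have scaled: "C \<le> ennreal (q * s) * A + ennreal ((1 - q) * s powr p) * B" if "s > 0" for s
  proof -
    have "C \<le> (\<integral>\<^sup>+x. ennreal (q * s) * (X x * Y x) + ennreal ((1 - q) * s powr p) * X x epowr p \<partial>M)"
      unfolding C_def
    proof (rule nn_integral_mono)
      fix x
      show "Y x epowr q \<le> ennreal (q * s) * (X x * Y x) + ennreal ((1 - q) * s powr p) * X x epowr p"
        using young_negative_exponent[OF p pq, of "Y x" "ennreal s * X x"] that q
        by (simp add: epowr_cmult ennreal_mult mult.assoc)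
    qed
    also have "\<dots> = ennreal (q * s) * A + ennreal ((1 - q) * s powr p) * B"
      unfolding A_def B_def by (subst nn_integral_add) (auto simp: nn_integral_cmult)
    finally show ?thesis .
  qed
  have "B epowr (1 / p) * C epowr (1 / q) \<le> A"
  proof (cases "C = 0 \<or> B = \<infinity> \<or> A = \<infinity>")
    case True
    then show ?thesis using p q by (auto simp: epowr_zero epowr_top)
  next
    case False
    then obtain a b where a: "A = ennreal a" "a \<ge> 0" and b: "B = ennreal b" "b \<ge> 0"
      by (cases A; cases B) auto
    have C_real: "C \<le> ennreal (q * s * a + (1 - q) * s powr p * b)" if "s > 0" for s
      using scaled[OF that] a b q that by (simp flip: ennreal_mult' ennreal_plus)
    from le_less_trans[OF C_real[of 1] ennreal_less_top] have "C < top" by simp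
    then obtain c where c: "C = ennreal c" "c > 0"
      using False by (cases C rule: ennreal_cases_pos) auto
    have le: "c \<le> q * s * a + (1 - q) * s powr p * b" if "s > 0" for s
      proof -
      have "0 \<le> q * s * a + (1 - q) * s powr p * b" using a b q that by simp
      then show ?thesis using C_real[OF that] unfolding c(1) by (subst (asm) ennreal_le_iff)
    qed
    \<comment> \<open>If \<open>A = 0\<close>, letting \<open>s\<close> tend to infinity forces \<open>C = 0\<close>, because \<open>p\<close> is negative.\<close>
    have "a > 0"
    proof (rule ccontr)
      assume "\<not> a > 0"
      then have a0: "a = 0" using a by simp
      have "((\<lambda>s. (1 - q) * s powr p * b) \<longlongrightarrow> (1 - q) * 0 * b) at_top"
        using p by (intro tendsto_intros tendsto_neg_powr filterlim_ident)
      then have "c \<le> (1 - q) * 0 * b"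
        by (rule tendsto_lowerbound)
           (use le a0 in \<open>auto intro!: eventually_mono[OF eventually_gt_at_top[of 0]]\<close>)
      then show False using c by simp
    qed
    have "b > 0"
    proof (rule ccontr)
      assume "\<not> b > 0"
      then have b0: "b = 0" using b by simp
      have "c \<le> q * (c / (2 * q * a)) * a" using le[of "c / (2 * q * a)"] b0 c q \<open>a > 0\<close> by simp
      then show False using c q \<open>a > 0\<close> by simp
    qed
    \<comment> \<open>The solution of \<open>s a = s\<^sup>p b\<close>, as \<open>1 / (1 - p) = 1 - q\<close>.\<close>
    define s where "s = (b / a) powr (1 - q)"
    have s: "s > 0" using \<open>a > 0\<close> \<open>b > 0\<close> by (simp add: s_def)
    have sp: "s powr p * b = s * a"
    proof -
      have "s powr p = s * s powr (p - 1)" using s by (simp add: powr_diff)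
      also have "s powr (p - 1) = (b / a) powr ((1 - q) * (p - 1))" by (simp add: s_def powr_powr)
      also have "(1 - q) * (p - 1) = -1" using q(3) by (simp add: algebra_simps)
      finally show ?thesis using \<open>a > 0\<close> \<open>b > 0\<close> by (simp add: powr_minus_divide)
    qed
    have "c \<le> q * (s * a) + (1 - q) * (s * a)" using le[OF s] sp by (simp add: mult.assoc)
    then have "c \<le> s * a" by (simp add: algebra_simps)
    also have "s * a = b powr (1 - q) * a powr q"
      using \<open>a > 0\<close> \<open>b > 0\<close> by (simp add: s_def powr_divide powr_diff)
    finally have "c powr (1 / q) \<le> (b powr (1 - q) * a powr q) powr (1 / q)"
      using c q by (intro powr_mono2) auto
    also have "\<dots> = b powr ((1 - q) / q) * a"
      using \<open>a > 0\<close> \<open>b > 0\<close> q by (simp add: powr_mult powr_powr)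
    also have "(1 - q) / q = - (1 / p)" using q p pq by (simp add: diff_divide_distrib)
    finally have "b powr (1 / p) * c powr (1 / q) \<le> b powr (1 / p) * (b powr (- (1 / p)) * a)"
      by (intro mult_left_mono) auto
    also have "\<dots> = a" using \<open>b > 0\<close> by (simp add: powr_minus)
    finally show ?thesis using a b c \<open>a > 0\<close> \<open>b > 0\<close>
      by (simp add: epowr_ennreal flip: ennreal_mult')
  qed
  then show ?thesis unfolding A_def B_def C_def .
qed

text \<open>
  Jensen's inequality for the convex function \<open>y\<^sup>p\<close> and the measure with density \<open>v\<close> and total mass
  \<open>c\<close>.  It is reverse Hoelder with the density distributed as \<open>v = v\<^sup>1\<^sup>/\<^sup>p v\<^sup>1\<^sup>/\<^sup>q\<close>.
\<close>

lemma jensen_negative_exponent: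
  fixes v :: "'a \<Rightarrow> real"
  assumes [measurable]: "v \<in> borel_measurable M" "f \<in> borel_measurable M"
    and v: "\<And>x. x \<in> space M \<Longrightarrow> v x > 0"
    and p: "p < 0" and pq: "1 / p + 1 / q = 1"
    and c: "(\<integral>\<^sup>+x. ennreal (v x) \<partial>M) = ennreal c" "c > 0"
  shows "(\<integral>\<^sup>+x. ennreal (v x) * f x \<partial>M) epowr p
    \<le> ennreal (c powr (p - 1)) * (\<integral>\<^sup>+x. ennreal (v x) * f x epowr p \<partial>M)"
proof -
  note q = conjugate_exponent[OF p pq]
  define B where "B = (\<integral>\<^sup>+x. ennreal (v x) * f x epowr p \<partial>M)"
  have "(\<integral>\<^sup>+x. (ennreal (v x powr (1 / p)) * f x) epowr p \<partial>M) epowr (1 / p)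
      * (\<integral>\<^sup>+x. ennreal (v x powr (1 / q)) epowr q \<partial>M) epowr (1 / q)
      \<le> (\<integral>\<^sup>+x. ennreal (v x powr (1 / p)) * f x * ennreal (v x powr (1 / q)) \<partial>M)"
    by (rule reverse_hoelder[OF _ _ p pq]) measurable
  also have "(\<integral>\<^sup>+x. (ennreal (v x powr (1 / p)) * f x) epowr p \<partial>M) = B"
    unfolding B_def using v p
    by (intro nn_integral_cong epowr_cmult_root) auto
  also have "(\<integral>\<^sup>+x. ennreal (v x powr (1 / q)) epowr q \<partial>M) = ennreal c"
    unfolding c(1)[symmetric] using v q(1)
    by (intro nn_integral_cong epowr_root) auto
  also have "(\<integral>\<^sup>+x. ennreal (v x powr (1 / p)) * f x * ennreal (v x powr (1 / q)) \<partial>M)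
      = (\<integral>\<^sup>+x. ennreal (v x) * f x \<partial>M)"
  proof (rule nn_integral_cong)
    fix x assume "x \<in> space M"
    then have "v x powr (1 / p) * v x powr (1 / q) = v x" using v pq by (simp flip: powr_add add: less_imp_le)
    then have "ennreal (v x powr (1 / p)) * ennreal (v x powr (1 / q)) = ennreal (v x)"
      by (simp flip: ennreal_mult')
    then show "ennreal (v x powr (1 / p)) * f x * ennreal (v x powr (1 / q)) = ennreal (v x) * f x"
      by (metis mult.assoc mult.commute)
  qed
  finally have "(\<integral>\<^sup>+x. ennreal (v x) * f x \<partial>M) epowr p
      \<le> (B epowr (1 / p) * ennreal c epowr (1 / q)) epowr p"
    by (intro epowr_antimono p)
  also have "\<dots> = ennreal (c powr (p / q)) * B"
    using c p by (simp add: epowr_ennreal mult.commute[of "B epowr (1 / p)"] epowr_cmult epowr_epowr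
        epowr_one powr_powr)
  finally show ?thesis by (simp add: B_def q)
qed

text \<open>
  The companion for the concave function \<open>y\<^sup>q\<close>, from the same splitting of the density.
\<close>

lemma jensen_fractional_exponent:
  fixes v :: "'a \<Rightarrow> real"
  assumes [measurable]: "v \<in> borel_measurable M" "f \<in> borel_measurable M"
    and v: "\<And>x. x \<in> space M \<Longrightarrow> v x > 0"
    and p: "p < 0" and pq: "1 / p + 1 / q = 1"
    and c: "(\<integral>\<^sup>+x. ennreal (v x) \<partial>M) = ennreal c" "c > 0"
  shows "ennreal (c powr (q - 1)) * (\<integral>\<^sup>+x. ennreal (v x) * f x epowr q \<partial>M)
    \<le> (\<integral>\<^sup>+x. ennreal (v x) * f x \<partial>M) epowr q"
proof -
  note q = conjugate_exponent[OF p pq]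
  define B where "B = (\<integral>\<^sup>+x. ennreal (v x) * f x epowr q \<partial>M)"
  have "(\<integral>\<^sup>+x. ennreal (v x powr (1 / p)) epowr p \<partial>M) epowr (1 / p)
      * (\<integral>\<^sup>+x. (ennreal (v x powr (1 / q)) * f x) epowr q \<partial>M) epowr (1 / q)
      \<le> (\<integral>\<^sup>+x. ennreal (v x powr (1 / p)) * (ennreal (v x powr (1 / q)) * f x) \<partial>M)"
    by (rule reverse_hoelder[OF _ _ p pq]) measurable
  also have "(\<integral>\<^sup>+x. (ennreal (v x powr (1 / q)) * f x) epowr q \<partial>M) = B"
    unfolding B_def using v q(1)
    by (intro nn_integral_cong epowr_cmult_root) auto
  also have "(\<integral>\<^sup>+x. ennreal (v x powr (1 / p)) epowr p \<partial>M) = ennreal c"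
    unfolding c(1)[symmetric] using v p
    by (intro nn_integral_cong epowr_root) auto
  also have "(\<integral>\<^sup>+x. ennreal (v x powr (1 / p)) * (ennreal (v x powr (1 / q)) * f x) \<partial>M)
      = (\<integral>\<^sup>+x. ennreal (v x) * f x \<partial>M)"
  proof (rule nn_integral_cong)
    fix x assume "x \<in> space M"
    then have "v x powr (1 / p) * v x powr (1 / q) = v x" using v pq by (simp flip: powr_add add: less_imp_le)
    then have "ennreal (v x powr (1 / p)) * ennreal (v x powr (1 / q)) = ennreal (v x)"
      by (simp flip: ennreal_mult')
    then show "ennreal (v x powr (1 / p)) * (ennreal (v x powr (1 / q)) * f x) = ennreal (v x) * f x"
      by (metis mult.assoc)
  qed
  finally have "(ennreal c epowr (1 / p) * B epowr (1 / q)) epowr q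
      \<le> (\<integral>\<^sup>+x. ennreal (v x) * f x \<partial>M) epowr q"
    by (intro epowr_mono q)
  moreover have "(ennreal c epowr (1 / p) * B epowr (1 / q)) epowr q = ennreal (c powr (q / p)) * B"
    using c q(1) by (simp add: epowr_ennreal epowr_cmult epowr_epowr epowr_one powr_powr)
  ultimately show ?thesis by (simp add: B_def q)
qed

section \<open>Strict comparison of integrals and the midpoint rule\<close>

lemma nn_integral_strict_mono:
  assumes [measurable]: "f \<in> borel_measurable M" "g \<in> borel_measurable M" "S \<in> sets M"
    and fin: "(\<integral>\<^sup>+x. f x \<partial>M) < \<infinity>"
    and le: "AE x in M. f x \<le> g x"
    and less: "AE x in M. x \<in> S \<longrightarrow> f x < g x"
    and S: "emeasure M S \<noteq> 0"
  shows "(\<integral>\<^sup>+x. f x \<partial>M) < (\<integral>\<^sup>+x. g x \<partial>M)"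
proof (rule nn_integral_less)
  show "\<not> (AE x in M. g x \<le> f x)"
  proof
    assume "AE x in M. g x \<le> f x"
    then have "AE x in M. x \<notin> S" using less by eventually_elim auto
    then have "S \<in> null_sets M" by (simp add: AE_iff_null_sets)
    then show False using S by (simp add: null_setsD1)
  qed
qed (use assms in auto)

text \<open>
  Reflecting the interval at its midpoint shows that twice the integral of \<open>h\<close> is the integral of
  \<open>h(v) + h(2m - v)\<close>, which exceeds \<open>2 h(m)\<close> away from the midpoint.  Only this comparison of
  symmetric points enters, so \<open>h\<close> may be unbounded at the ends of the interval.
\<close>

lemma midpoint_rule_strict:
  fixes h :: "real \<Rightarrow> real"
  assumes [measurable]: "h \<in> borel_measurable borel"
    and r: "0 < r"
    and nonneg: "\<And>v. v \<in> {m - r<..<m + r} \<Longrightarrow> 0 \<le> h v"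
    and mid: "\<And>s. 0 < s \<Longrightarrow> s < r \<Longrightarrow> 2 * h m < h (m + s) + h (m - s)"
  shows "ennreal (2 * r * h m) < (\<integral>\<^sup>+v\<in>{m - r<..<m + r}. ennreal (h v) \<partial>lborel)"
proof -
  define I where "I = {m - r<..<m + r}"
  have [measurable]: "I \<in> sets borel" by (simp add: I_def)
  have hm: "h m \<ge> 0" using nonneg r by simp
  have refl: "(\<integral>\<^sup>+v\<in>I. ennreal (h (2 * m - v)) \<partial>lborel) = (\<integral>\<^sup>+v\<in>I. ennreal (h v) \<partial>lborel)"
    by (subst nn_integral_real_affine[where c = "-1" and t = "2 * m"])
       (auto intro!: nn_integral_cong simp: I_def indicator_def)
  have "ennreal 2 * ennreal (2 * r * h m) = (\<integral>\<^sup>+v\<in>I. ennreal (2 * h m) \<partial>lborel)"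
  proof -
    have "ennreal 2 * ennreal (2 * r * h m) = ennreal (2 * h m) * ennreal (2 * r)"
      using r hm by (simp only: ennreal_mult'[symmetric]) (simp add: ac_simps)
    then show ?thesis using r by (simp add: nn_integral_cmult_indicator I_def)
  qed
  also have "\<dots> < (\<integral>\<^sup>+v. (ennreal (h v) * indicator I v + ennreal (h (2 * m - v)) * indicator I v) \<partial>lborel)"
  proof (rule nn_integral_strict_mono)
    have less: "ennreal (2 * h m) * indicator I v
        < ennreal (h v) * indicator I v + ennreal (h (2 * m - v)) * indicator I v"
      if v: "v \<in> I" "v \<noteq> m" for v
    proof -
      have "2 * h m < h (m + \<bar>v - m\<bar>) + h (m - \<bar>v - m\<bar>)"
        using v by (intro mid) (auto simp: I_def)
      also have "\<dots> = h v + h (2 * m - v)" by (cases "v \<ge> m") (auto simp: abs_if)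
      finally show ?thesis using v nonneg[of v] nonneg[of "2 * m - v"]
        by (simp add: I_def hm ennreal_less_iff flip: ennreal_plus)
    qed
    have "AE v in lborel. v \<noteq> m" by (rule AE_lborel_singleton)
    then show "AE v in lborel. ennreal (2 * h m) * indicator I v
        \<le> ennreal (h v) * indicator I v + ennreal (h (2 * m - v)) * indicator I v"
      "AE v in lborel. v \<in> I \<longrightarrow> ennreal (2 * h m) * indicator I v
        < ennreal (h v) * indicator I v + ennreal (h (2 * m - v)) * indicator I v"
      by (eventually_elim, use less in \<open>fastforce simp: indicator_def less_imp_le\<close>)+
    show "emeasure lborel I \<noteq> 0" using r by (simp add: I_def)
    show "(\<integral>\<^sup>+v\<in>I. ennreal (2 * h m) \<partial>lborel) < \<infinity>"
      using r hm by (simp add: nn_integral_cmult_indicator I_def flip: ennreal_mult')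
  qed measurable
  also have "\<dots> = ennreal 2 * (\<integral>\<^sup>+v\<in>I. ennreal (h v) \<partial>lborel)"
    by (subst nn_integral_add) (simp_all add: refl flip: mult_2)
  finally have "\<not> (\<integral>\<^sup>+v\<in>I. ennreal (h v) \<partial>lborel) \<le> ennreal (2 * r * h m)"
    using mult_left_mono[of _ _ "ennreal 2"] by (meson leD zero_le)
  then show ?thesis unfolding I_def by (simp add: not_le)
qed

lemma suminf_strict_mono_ennreal:
  fixes f g :: "nat \<Rightarrow> ennreal"
  assumes "(\<Sum>n. f n) < \<infinity>" "\<And>n. f n < g n"
  shows "(\<Sum>n. f n) < (\<Sum>n. g n)"
proof -
  have "(\<integral>\<^sup>+n. f n \<partial>count_space UNIV) < (\<integral>\<^sup>+n. g n \<partial>count_space UNIV)"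
    using assms
    by (intro nn_integral_strict_mono[where S = UNIV])
       (auto simp: nn_integral_count_space_nat less_imp_le)
  then show ?thesis by (simp add: nn_integral_count_space_nat)
qed

section \<open>The hyperbolic kernel and its moments\<close>

lemma csch_pos: "u > 0 \<Longrightarrow> csch u > 0"
  by (simp add: csch_def)

lemma csch_strict_antimono: "0 < u \<Longrightarrow> u < v \<Longrightarrow> csch v < csch u"
  unfolding csch_def
  by (intro divide_strict_left_mono mult_pos_pos) (auto intro!: diff_strict_mono)

lemma borel_measurable_csch [measurable]: "csch \<in> borel_measurable borel"
  unfolding csch_def[abs_def] by measurable

lemma csch_le_inverse:
  assumes "u > 0" shows "csch u \<le> 1 / u"
proof -
  have "u \<le> sinh u" using assms real_le_x_sinh[of u] by (simp add: sinh_field_def exp_minus)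
  then have "2 * u \<le> exp u - exp (- u)" by (simp add: sinh_field_def)
  then show ?thesis unfolding csch_def using assms by (simp add: field_simps)
qed

text \<open>
  The function \<open>sinh\<close> is logarithmically concave, as \<open>sinh\<^sup>2((a + b)/2) - sinh(a) sinh(b) = sinh\<^sup>2((a - b)/2)\<close>.
  With \<open>A = e\<^sup>a\<^sup>/\<^sup>2\<close> and \<open>B = e\<^sup>b\<^sup>/\<^sup>2\<close> this is a rational identity.
\<close>

lemma csch_mult_ge:
  assumes "a > 0" "b > 0"
  shows "csch ((a + b) / 2) ^ 2 \<le> csch a * csch b"
proof -
  define A B where "A = exp (a / 2)" and "B = exp (b / 2)"
  have AB: "A > 1" "B > 1" using assms by (auto simp: A_def B_def)
  have e: "exp a = A^2" "exp (-a) = 1 / A^2" "exp b = B^2" "exp (-b) = 1 / B^2"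
    "exp ((a + b) / 2) = A * B" "exp (- ((a + b) / 2)) = 1 / (A * B)"
    by (auto simp: A_def B_def exp_minus field_simps simp flip: exp_double exp_add)
  have "(A^2 - 1/A^2) * (B^2 - 1/B^2) \<le> (A * B - 1 / (A * B))^2"
  proof -
    have "(A * B - 1 / (A * B))^2 - (A^2 - 1/A^2) * (B^2 - 1/B^2) = (A / B - B / A)^2"
      using AB by (simp add: field_simps power2_eq_square)
    then show ?thesis by (smt (verit) zero_le_power2)
  qed
  moreover have "A^2 - 1/A^2 > 0" "B^2 - 1/B^2 > 0"
  proof -
    have "exp (- a) < exp a" "exp (- b) < exp b" using assms by simp_all
    then show "A^2 - 1/A^2 > 0" "B^2 - 1/B^2 > 0" unfolding e by simp_all
  qed
  then have "(A^2 - 1/A^2) * (B^2 - 1/B^2) > 0" by (rule mult_pos_pos)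
  ultimately have "4 / (A * B - 1 / (A * B))^2 \<le> 4 / ((A^2 - 1/A^2) * (B^2 - 1/B^2))"
    by (intro frac_le) simp_all
  then show ?thesis unfolding csch_def e by (simp add: power_divide)
qed

text \<open>
  The profile of the kernel \<open>H\<close>, which depends on \<open>x\<close> and \<open>n\<close> through the product \<open>U(x)\<^sup>\<delta> W\<^sub>n\<close> only.
\<close>

definition kern :: "real \<Rightarrow> real \<Rightarrow> real \<Rightarrow> real \<Rightarrow> real" where
  "kern \<alpha> \<rho> \<gamma> t = csch (\<rho> * t powr \<gamma>) / exp (\<alpha> * t powr \<gamma>)"

lemma borel_measurable_kern [measurable]: "kern \<alpha> \<rho> \<gamma> \<in> borel_measurable borel"
  unfolding kern_def[abs_def] by measurable

lemma k_const_kern: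
  "k_const \<alpha> \<rho> \<gamma> s = (\<integral>\<^sup>+t\<in>{0<..}. ennreal (kern \<alpha> \<rho> \<gamma> t * t powr (s - 1)) \<partial>lborel)"
  unfolding k_const_def kern_def nn_integral_completion ..

lemma nn_integral_powr_0_1:
  assumes "a > -1"
  shows "(\<integral>\<^sup>+t\<in>{0..1}. ennreal (t powr a) \<partial>lborel) = ennreal (1 / (a + 1))"
  using nn_integral_has_integral_lebesgue'[OF _ has_integral_powr_from_0[of a 1]] assms by simp

lemma nn_integral_powr_1_inf:
  assumes "a < -1"
  shows "(\<integral>\<^sup>+t\<in>{1..}. ennreal (t powr a) \<partial>lborel) = ennreal (- 1 / (a + 1))"
  using nn_integral_has_integral_lebesgue'[OF _ has_integral_powr_to_inf[of a 1]] assms by simp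

text \<open>
  The powers \<open>t\<^sup>s\<^sup>-\<^sup>1\<close> are convex in \<open>s\<close>, hence so are the moments.  Optimality uses this as an explicit
  form of semicontinuity: between \<open>s'\<close> and \<open>\<sigma>\<close>, the moment stays below its linear interpolation, which
  tends to \<open>k(\<sigma>)\<close>.
\<close>

lemma k_const_convex:
  assumes "0 \<le> \<theta>" "\<theta> \<le> 1" "\<rho> > 0"
  shows "k_const \<alpha> \<rho> \<gamma> ((1 - \<theta>) * s + \<theta> * s')
    \<le> ennreal (1 - \<theta>) * k_const \<alpha> \<rho> \<gamma> s + ennreal \<theta> * k_const \<alpha> \<rho> \<gamma> s'"
proof -
  have "k_const \<alpha> \<rho> \<gamma> ((1 - \<theta>) * s + \<theta> * s') \<le>
     (\<integral>\<^sup>+t. ennreal (1 - \<theta>) * (ennreal (kern \<alpha> \<rho> \<gamma> t * t powr (s - 1)) * indicator {0<..} t)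
      + ennreal \<theta> * (ennreal (kern \<alpha> \<rho> \<gamma> t * t powr (s' - 1)) * indicator {0<..} t) \<partial>lborel)"
    unfolding k_const_kern
  proof (rule nn_integral_mono)
    fix t :: real
    show "ennreal (kern \<alpha> \<rho> \<gamma> t * t powr ((1 - \<theta>) * s + \<theta> * s' - 1)) * indicator {0<..} t
      \<le> ennreal (1 - \<theta>) * (ennreal (kern \<alpha> \<rho> \<gamma> t * t powr (s - 1)) * indicator {0<..} t)
      + ennreal \<theta> * (ennreal (kern \<alpha> \<rho> \<gamma> t * t powr (s' - 1)) * indicator {0<..} t)"
    proof (cases "t > 0")
      case True
      have "t powr ((1 - \<theta>) * s + \<theta> * s' - 1)
          = (t powr (s - 1)) powr (1 - \<theta>) * (t powr (s' - 1)) powr \<theta>"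
        by (simp add: powr_powr algebra_simps flip: powr_add)
      also have "\<dots> \<le> (1 - \<theta>) * t powr (s - 1) + \<theta> * t powr (s' - 1)"
        using assms True by (intro Youngs_inequality_0) auto
      finally have "kern \<alpha> \<rho> \<gamma> t * t powr ((1 - \<theta>) * s + \<theta> * s' - 1)
          \<le> kern \<alpha> \<rho> \<gamma> t * ((1 - \<theta>) * t powr (s - 1) + \<theta> * t powr (s' - 1))"
        using True assms by (intro mult_left_mono) (auto simp: kern_def csch_pos less_imp_le)
      also have "\<dots> = (1 - \<theta>) * (kern \<alpha> \<rho> \<gamma> t * t powr (s - 1)) + \<theta> * (kern \<alpha> \<rho> \<gamma> t * t powr (s' - 1))"
        by (simp add: algebra_simps)
      finally have "ennreal (kern \<alpha> \<rho> \<gamma> t * t powr ((1 - \<theta>) * s + \<theta> * s' - 1)) \<le> ennreal \<dots>"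
        by (rule ennreal_leI)
      moreover have "kern \<alpha> \<rho> \<gamma> t \<ge> 0"
        using True assms by (auto simp: kern_def csch_pos less_imp_le)
      ultimately show ?thesis using True assms
        by (simp add: ennreal_mult' ennreal_plus)
    qed simp
  qed
  also have "\<dots> = ennreal (1 - \<theta>) * k_const \<alpha> \<rho> \<gamma> s + ennreal \<theta> * k_const \<alpha> \<rho> \<gamma> s'"
    unfolding k_const_kern by (subst nn_integral_add) (auto simp: nn_integral_cmult)
  finally show ?thesis .
qed

text \<open>
  Concavity of \<open>x\<^sup>g\<close>, from its tangent at \<open>m\<close>.
\<close>

lemma powr_midpoint_le:
  fixes g :: real
  assumes "0 < g" "g \<le> 1" "0 < s" "s < m"
  shows "(m + s) powr g + (m - s) powr g \<le> 2 * m powr g"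
proof -
  have *: "x powr g \<le> m powr g * (g * (x / m) + (1 - g))" if "x > 0" for x
    using Youngs_inequality_0[of g "1 - g" "x / m" 1] that assms
    by (simp add: powr_divide field_simps)
  have "(m + s) powr g + (m - s) powr g
      \<le> m powr g * (g * ((m + s) / m) + (1 - g)) + m powr g * (g * ((m - s) / m) + (1 - g))"
    using assms by (intro add_mono *) auto
  also have "\<dots> = 2 * m powr g" using assms by (simp add: field_simps)
  finally show ?thesis .
qed

locale hyperbolic_kernel =
  fixes \<alpha> \<rho> \<gamma> :: real
  assumes \<alpha>: "0 \<le> \<alpha>" and \<rho>: "0 < \<rho>" and \<gamma>: "0 < \<gamma>" "\<gamma> \<le> 1"
begin

abbreviation "K \<equiv> kern \<alpha> \<rho> \<gamma>"
abbreviation "k \<equiv> k_const \<alpha> \<rho> \<gamma>"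

lemma kern_pos: "t > 0 \<Longrightarrow> K t > 0"
  using \<rho> by (simp add: kern_def csch_pos)

lemma kern_strict_antimono:
  assumes "0 < t" "t < t'" shows "K t' < K t"
  unfolding kern_def
proof (rule frac_less)
  show "exp (\<alpha> * t powr \<gamma>) \<le> exp (\<alpha> * t' powr \<gamma>)"
    using assms \<alpha> \<gamma> by (auto intro!: mult_left_mono powr_mono2)
qed (use assms \<rho> \<gamma> in \<open>auto intro!: csch_strict_antimono powr_less_mono2 csch_pos less_imp_le\<close>)

text \<open>
  Both factors are decreasing logarithmically convex functions of \<open>t\<^sup>\<gamma>\<close>, and \<open>t\<^sup>\<gamma>\<close> is concave in \<open>t\<close>.
\<close>

lemma kern_midpoint:
  assumes s: "0 < s" "s < m"
  shows "K m ^ 2 \<le> K (m + s) * K (m - s)"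
proof -
  define a b c where "a = (m + s) powr \<gamma>" and "b = (m - s) powr \<gamma>" and "c = m powr \<gamma>"
  have pos: "a > 0" "b > 0" "c > 0" using s by (auto simp: a_def b_def c_def)
  have conc: "a + b \<le> 2 * c" unfolding a_def b_def c_def using powr_midpoint_le \<gamma> s by blast
  have "csch (\<rho> * c) \<le> csch ((\<rho> * a + \<rho> * b) / 2)"
  proof (cases "a + b = 2 * c")
    case True
    then have "(\<rho> * a + \<rho> * b) / 2 = \<rho> * c" by (simp flip: distrib_left)
    then show ?thesis by simp
  next
    case False
    then have "(\<rho> * a + \<rho> * b) / 2 < \<rho> * c" using conc \<rho> by (simp flip: distrib_left)
    then show ?thesis using csch_strict_antimono pos \<rho> by (simp add: less_imp_le add_pos_pos)
  qed
  then have "csch (\<rho> * c) ^ 2 \<le> csch ((\<rho> * a + \<rho> * b) / 2) ^ 2"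
    using pos \<rho> by (intro power_mono) (simp_all add: less_imp_le[OF csch_pos])
  also have "\<dots> \<le> csch (\<rho> * a) * csch (\<rho> * b)"
    using pos \<rho> by (intro csch_mult_ge) auto
  finally have 1: "csch (\<rho> * c) ^ 2 \<le> csch (\<rho> * a) * csch (\<rho> * b)" .
  have "exp (\<alpha> * a) * exp (\<alpha> * b) \<le> exp (\<alpha> * c) ^ 2"
    using mult_left_mono[OF conc \<alpha>] by (simp flip: exp_add exp_double add: algebra_simps)
  then have "csch (\<rho> * c) ^ 2 / exp (\<alpha> * c) ^ 2
      \<le> csch (\<rho> * a) * csch (\<rho> * b) / (exp (\<alpha> * a) * exp (\<alpha> * b))"
    using 1 order_trans[OF zero_le_power2 1] by (intro frac_le) auto
  then show ?thesis unfolding kern_def a_def b_def c_def by (simp add: power_divide)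
qed

text \<open>
  For a logarithmically convex function, \<open>h(m)\<close> is at most the geometric mean of \<open>h(m + s)\<close> and
  \<open>h(m - s)\<close>.  The passage to the arithmetic mean is strict because \<open>h\<close> is strictly
  decreasing, so that the two values differ.
\<close>

lemma kern_powr_midpoint_strict:
  assumes s: "0 < s" "s < m" and \<sigma>: "\<sigma> \<le> 1"
  shows "2 * (K m * m powr (\<sigma> - 1))
    < K (m + s) * (m + s) powr (\<sigma> - 1) + K (m - s) * (m - s) powr (\<sigma> - 1)"
proof -
  define x y z where "x = K (m + s) * (m + s) powr (\<sigma> - 1)"
    and "y = K (m - s) * (m - s) powr (\<sigma> - 1)" and "z = K m * m powr (\<sigma> - 1)"
  have pos: "x > 0" "y > 0" "z > 0" using s kern_pos by (auto simp: x_def y_def z_def)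
  have "x < y" unfolding x_def y_def
  proof (rule mult_less_le_imp_less)
    show "K (m + s) < K (m - s)" using s by (intro kern_strict_antimono) auto
    show "(m + s) powr (\<sigma> - 1) \<le> (m - s) powr (\<sigma> - 1)" using s \<sigma> by (intro powr_mono2') auto
  qed (use s kern_pos[of "m + s"] in simp_all)
  have "z ^ 2 = K m ^ 2 * (m * m) powr (\<sigma> - 1)"
    using s by (simp add: z_def power_mult_distrib powr_mult power2_eq_square)
  also have "\<dots> \<le> (K (m + s) * K (m - s)) * ((m + s) * (m - s)) powr (\<sigma> - 1)"
  proof (rule mult_mono)
    have "(m + s) * (m - s) \<le> m * m" by (simp add: algebra_simps)
    then show "(m * m) powr (\<sigma> - 1) \<le> ((m + s) * (m - s)) powr (\<sigma> - 1)"
      using s \<sigma> by (intro powr_mono2') auto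
    have "K (m + s) > 0" "K (m - s) > 0" using s by (simp_all add: kern_pos)
    then show "0 \<le> K (m + s) * K (m - s)" by simp
  qed (use s kern_midpoint in simp_all)
  also have "\<dots> = x * y" using s by (simp add: x_def y_def powr_mult)
  finally have "4 * z ^ 2 \<le> 4 * (x * y)" by simp
  also have "\<dots> < (x + y) ^ 2"
  proof -
    have "(x + y) ^ 2 - 4 * (x * y) = (x - y) ^ 2" by (simp add: power2_eq_square algebra_simps)
    moreover have "(x - y) ^ 2 > 0" using \<open>x < y\<close> by simp
    ultimately show ?thesis by linarith
  qed
  finally have "(2 * z) ^ 2 < (x + y) ^ 2" by (simp add: power_mult_distrib)
  then have "2 * z < x + y" by (rule power_less_imp_less_base) (use pos in simp)
  then show ?thesis by (simp add: x_def y_def z_def)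
qed

lemma k_pos: "k s > 0"
proof -
  have "(\<integral>\<^sup>+(t::real). 0 \<partial>lborel) < k s"
    unfolding k_const_kern
    by (rule nn_integral_strict_mono[of _ _ _ "{0<..<1}"]) (simp_all add: kern_pos)
  then show ?thesis by simp
qed

text \<open>
  Exponential decay in the weak form that is used: \<open>(u/b)\<^sup>b \<le> e\<^sup>u\<close> with \<open>b = a/\<gamma>\<close> and \<open>u = \<rho> t\<^sup>\<gamma>\<close>.
\<close>

lemma kern_decay:
  assumes "a > 0"
  obtains C where "C > 0" "\<And>t. t \<ge> 1 \<Longrightarrow> K t \<le> C * t powr - a"
proof -
  define b where "b = a / \<gamma>"
  define c where "c = 1 - exp (- 2 * \<rho>)"
  define C where "C = 2 / (c * (\<rho> / b) powr b)"
  have b: "b > 0" using assms \<gamma> by (simp add: b_def)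
  have c: "c > 0" using \<rho> by (simp add: c_def)
  have "K t \<le> C * t powr - a" if "t \<ge> 1" for t
  proof -
    define u where "u = \<rho> * t powr \<gamma>"
    have u: "u \<ge> \<rho>" using that \<rho> \<gamma> by (simp add: u_def ge_one_powr_ge_zero)
    have "u / b \<le> exp (u / b)" by (rule order_trans[OF _ exp_ge_add_one_self]) simp
    then have "(u / b) powr b \<le> exp (u / b) powr b"
      using b u \<rho> by (intro powr_mono2) auto
    also have "\<dots> = exp u" using b by (simp add: exp_powr_real)
    finally have 1: "(u / b) powr b \<le> exp u" .
    have "exp (- u) \<le> exp u * exp (- 2 * \<rho>)" using u by (simp flip: exp_add)
    then have "exp u * c \<le> exp u - exp (- u)" by (simp add: c_def algebra_simps)
    moreover have "(u / b) powr b * c \<le> exp u * c" using 1 c by simp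
    ultimately have 2: "(u / b) powr b * c \<le> exp u - exp (- u)" by linarith
    have pos: "(u / b) powr b * c > 0" using u \<rho> b c by simp
    have "K t \<le> csch u"
      using that \<alpha> csch_pos[of u] u \<rho>
      by (simp add: kern_def flip: u_def) (simp add: divide_le_eq mult_le_cancel_left1)
    also have "\<dots> \<le> 2 / ((u / b) powr b * c)"
      unfolding csch_def using 2 pos by (intro frac_le) auto
    also have "(u / b) powr b = (\<rho> / b) powr b * t powr a"
      using that b \<rho> \<gamma> by (simp add: u_def powr_mult powr_divide powr_powr b_def)
    finally show ?thesis by (simp add: C_def powr_minus field_simps)
  qed
  moreover have "C > 0" using b c \<rho> by (simp add: C_def)
  ultimately show ?thesis by (rule that[rotated])
qed

text \<open>
  Near 0 the kernel is at most \<open>t\<^sup>-\<^sup>\<gamma>/\<rho>\<close>, which is why \<open>s > \<gamma>\<close> is required; near infinity it beats every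
  power.
\<close>

lemma k_finite:
  assumes s: "s > \<gamma>" shows "k s < \<infinity>"
proof -
  obtain C where C: "C > 0" "\<And>t. t \<ge> 1 \<Longrightarrow> K t \<le> C * t powr - (s + 1)"
    using kern_decay[of "s + 1"] s \<gamma> by auto
  have "k s \<le> (\<integral>\<^sup>+t. ennreal (1 / \<rho>) * (ennreal (t powr (s - 1 - \<gamma>)) * indicator {0..1} t)
      + ennreal C * (ennreal (t powr (-2)) * indicator {1..} t) \<partial>lborel)"
    unfolding k_const_kern
  proof (rule nn_integral_mono)
    fix t :: real
    consider "t \<le> 0" | "0 < t" "t < 1" | "t \<ge> 1" by linarith
    then show "ennreal (K t * t powr (s - 1)) * indicator {0<..} t
      \<le> ennreal (1 / \<rho>) * (ennreal (t powr (s - 1 - \<gamma>)) * indicator {0..1} t)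
        + ennreal C * (ennreal (t powr (-2)) * indicator {1..} t)"
    proof cases
      case 2
      have "K t \<le> csch (\<rho> * t powr \<gamma>)"
        using 2 \<alpha> csch_pos[of "\<rho> * t powr \<gamma>"] \<rho> by (simp add: kern_def divide_le_eq mult_le_cancel_left1)
      also have "\<dots> \<le> 1 / (\<rho> * t powr \<gamma>)" using 2 \<rho> by (intro csch_le_inverse) auto
      finally have "K t * t powr (s - 1) \<le> 1 / (\<rho> * t powr \<gamma>) * t powr (s - 1)"
        by (intro mult_right_mono) auto
      also have "\<dots> = 1 / \<rho> * t powr (s - 1 - \<gamma>)" by (simp add: powr_diff)
      finally show ?thesis using 2 \<rho> by (simp flip: ennreal_mult')
    next
      case 3
      have "K t * t powr (s - 1) \<le> C * t powr - (s + 1) * t powr (s - 1)"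
        using C 3 by (intro mult_right_mono) auto
      also have "\<dots> = C * t powr (-2)" by (simp add: mult.assoc flip: powr_add)
      finally have "ennreal (K t * t powr (s - 1)) \<le> ennreal C * ennreal (t powr (-2))"
        using C by (simp flip: ennreal_mult')
      then show ?thesis using 3 by (simp add: add_increasing)
    qed simp
  qed
  also have "\<dots> = ennreal (1 / \<rho>) * ennreal (1 / (s - 1 - \<gamma> + 1)) + ennreal C * ennreal (- 1 / (-2 + 1))"
    using s
    by (subst nn_integral_add)
       (auto simp: nn_integral_cmult nn_integral_powr_0_1 nn_integral_powr_1_inf simp del: powr_neg_numeral)
  also have "\<dots> < \<infinity>" by (simp add: ennreal_mult_less_top)
  finally show ?thesis .
qed

end

section \<open>The substitution $t = c\,U(x)^\delta$\<close>

text \<open>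
  The hypotheses under which the three inequalities hold; optimality adds those of
  \<open>half_discrete_divergent\<close>.
\<close>

locale half_discrete = hyperbolic_kernel +
  fixes \<sigma> \<delta> p q :: real and \<mu> :: "real \<Rightarrow> real" and \<nu> \<nu>t :: "nat \<Rightarrow> real"
  assumes \<sigma>: "\<gamma> < \<sigma>" "\<sigma> \<le> 1"
    and \<delta>: "\<delta> \<in> {-1, 1}"
    and p: "p < 0" and pq: "1 / p + 1 / q = 1"
    and \<mu>_cont: "continuous_on {0<..} \<mu>" and \<mu>_pos: "\<And>t. t > 0 \<Longrightarrow> \<mu> t > 0"
    and \<mu>_integrable: "\<And>x. x > 0 \<Longrightarrow> set_integrable lebesgue {0<..<x} \<mu>"
    and \<nu>_pos: "\<And>n. n \<ge> 1 \<Longrightarrow> \<nu> n > 0"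
    and \<nu>t: "\<And>n. n \<ge> 1 \<Longrightarrow> \<nu>t n \<in> {0..\<nu> n / 2}"
    and U_infty: "U_infty \<mu> = \<infinity>"
begin

lemmas q = conjugate_exponent[OF p pq]

abbreviation "U \<equiv> U_fun \<mu>"
abbreviation "V \<equiv> partial_sum \<nu>"
abbreviation "W \<equiv> V_tilde \<nu> \<nu>t"
abbreviation "H \<equiv> H_kernel \<alpha> \<rho> \<gamma> \<delta> \<mu> \<nu> \<nu>t"
abbreviation "L \<equiv> lebesgue_on {0::real<..}"

lemma nn_integral_L:
  "(\<integral>\<^sup>+x\<in>{0<..}. f x \<partial>lebesgue) = (\<integral>\<^sup>+x. f x \<partial>L)"
  by (subst nn_integral_restrict_space) auto

lemma emeasure_L: "emeasure L {0<..} \<noteq> 0"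
proof -
  have "emeasure lborel {0<..<1::real} \<le> emeasure lborel {0::real<..}" by (rule emeasure_mono) auto
  then show ?thesis by (auto simp: emeasure_restrict_space)
qed

lemma H_kern: "H x n = K (U x powr \<delta> * W n)"
  by (simp add: H_kernel_def kern_def)

text \<open>
  The integral defining \<open>U\<close> is a Lebesgue integral over an open interval; calculus is done with the
  gauge integral over closed intervals starting at 0, where \<open>\<mu>\<close> may be unbounded.
\<close>

lemma \<mu>_integrable_on: "\<mu> integrable_on {0..x}"
proof (cases "x > 0")
  case True
  then show ?thesis
    using set_lebesgue_integral_eq_integral(1)[OF \<mu>_integrable] by (simp add: integrable_on_open_interval_real)
next
  case False
  then show ?thesis using integrable_on_refl[of \<mu> x] by (cases "x = 0") auto
qed

lemma U_integral: "x \<ge> 0 \<Longrightarrow> U x = integral {0..x} \<mu>"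
proof (cases "x > 0")
  case True
  then show ?thesis unfolding U_fun_def
    by (simp add: set_lebesgue_integral_eq_integral(2)[OF \<mu>_integrable] integral_open_interval_real)
qed (simp_all add: U_fun_def set_lebesgue_integral_def)

lemma U_cont: "continuous_on {0..x} U"
proof -
  have "continuous_on {0..x} (\<lambda>x. integral {0..x} \<mu>)"
    by (intro indefinite_integral_continuous_1 \<mu>_integrable_on)
  moreover have "U y = integral {0..y} \<mu>" if "y \<in> {0..x}" for y using that U_integral by simp
  ultimately show ?thesis by (subst continuous_on_cong[OF refl]) auto
qed

lemma U_deriv:
  assumes "x > 0" shows "(U has_real_derivative \<mu> x) (at x)"
proof -
  have "((\<lambda>y. integral {x/2..y} \<mu>) has_real_derivative \<mu> x) (at x within {x/2..2*x})"
    using assms by (intro integral_has_real_derivative continuous_on_subset[OF \<mu>_cont]) auto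
  then have "((\<lambda>y. integral {x/2..y} \<mu>) has_real_derivative \<mu> x) (at x)"
    using assms by (simp add: at_within_Icc_at)
  then have "((\<lambda>y. integral {0..x/2} \<mu> + integral {x/2..y} \<mu>) has_real_derivative \<mu> x) (at x)"
    by (auto intro!: derivative_eq_intros)
  then show ?thesis
  proof (rule has_field_derivative_transform_within_open)
    show "open {x/2<..}" "x \<in> {x/2<..}" using assms by auto
    fix y assume y: "y \<in> {x/2<..}"
    then show "integral {0..x/2} \<mu> + integral {x/2..y} \<mu> = U y"
      using assms by (simp add: U_integral Henstock_Kurzweil_Integration.integral_combine[OF _ _ \<mu>_integrable_on])
  qed
qed

lemma U_strict_mono: "0 < x \<Longrightarrow> x < y \<Longrightarrow> U x < U y"
  by (rule DERIV_pos_imp_increasing[of x y U]) (meson U_deriv \<mu>_pos less_le_trans)+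

lemma U_pos: assumes "x > 0" shows "U x > 0"
proof -
  have "0 \<le> U (x/2)"
    using assms \<mu>_pos
    by (simp add: U_integral integral_open_interval_real) 
       (rule Henstock_Kurzweil_Integration.integral_nonneg,
        use \<mu>_integrable_on in \<open>auto simp: integrable_on_open_interval_real less_imp_le\<close>)
  also have "\<dots> < U x" using assms by (intro U_strict_mono) auto
  finally show ?thesis .
qed

lemma U_unbounded: "\<exists>x>0. U x > B"
proof (rule ccontr)
  assume *: "\<not> ?thesis"
  define M where "M = density lebesgue (\<lambda>t. ennreal (\<mu> t) * indicator {0<..} t)"
  have meas: "(\<lambda>t. ennreal (\<mu> t) * indicator {0<..} t) \<in> borel_measurable lebesgue"
  proof -
    have "\<mu> \<in> borel_measurable L"
      by (intro continuous_imp_measurable_on_sets_lebesgue \<mu>_cont) auto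
    then have "(\<lambda>t. ennreal (\<mu> t)) \<in> borel_measurable L" by simp
    then show ?thesis by (simp add: borel_measurable_restrict_space_iff_ennreal)
  qed
  have em: "emeasure M A = (\<integral>\<^sup>+t\<in>A \<inter> {0<..}. ennreal (\<mu> t) \<partial>lebesgue)" if "A \<in> sets lebesgue" for A
    using that meas by (simp add: M_def emeasure_density) (auto intro!: nn_integral_cong simp: indicator_def)
  have "emeasure M {0<..<real (Suc n)} \<le> ennreal B" for n
  proof -
    define N where "N = real (Suc n)"
    have "\<mu> integrable_on {0<..<N}"
      using \<mu>_integrable_on[of N] by (simp add: integrable_on_open_interval_real)
    then have "(\<integral>\<^sup>+t\<in>{0<..<N}. ennreal (\<mu> t) \<partial>lborel) = ennreal (integral {0<..<N} \<mu>)"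
      by (intro nn_integral_has_integral_lebesgue' integrable_integral) (auto simp: \<mu>_pos less_imp_le)
    moreover have "integral {0<..<N} \<mu> = U N"
      using U_integral[of N] by (simp add: N_def integral_open_interval_real)
    moreover have "U N \<le> B" proof -
      have "N > 0" by (simp add: N_def)
      then show ?thesis using * by (meson not_less)
    qed
    moreover have "{0<..<N} \<inter> {0<..} = {0<..<N}" by auto
    ultimately show ?thesis
      unfolding N_def[symmetric] by (simp add: em nn_integral_completion ennreal_leI)
  qed
  then have "(SUP n. emeasure M {0<..<real (Suc n)}) \<le> ennreal B" by (intro SUP_least) 
  also have "(SUP n. emeasure M {0<..<real (Suc n)}) = emeasure M (\<Union>n. {0<..<real (Suc n)})"
    by (intro SUP_emeasure_incseq) (auto simp: M_def incseq_def)
  also have "(\<Union>n. {0<..<real (Suc n)}) = {0<..}"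
  proof (intro equalityI subsetI)
    fix x :: real assume "x \<in> {0<..}"
    moreover obtain n where "x < real n" using reals_Archimedean2 by blast
    ultimately have "x \<in> {0<..<real (Suc n)}" by simp
    then show "x \<in> (\<Union>n. {0<..<real (Suc n)})" by blast
  qed auto
  also have "emeasure M {0<..} = \<infinity>" using U_infty by (subst em) (auto simp: U_infty_def)
  finally show False by (simp add: top_unique)
qed

lemma U_image: assumes "y > 0" obtains x where "x > 0" "U x = y"
proof -
  obtain b where b: "b > 0" "U b > y" using U_unbounded by blast
  have "U 0 = 0" by (simp add: U_integral)
  then obtain x where "0 \<le> x" "x \<le> b" "U x = y"
    using IVT'[of U 0 y b] b assms U_cont[of b] by auto
  with \<open>U 0 = 0\<close> assms have "x > 0" by (cases "x = 0") auto
  with \<open>U x = y\<close> that show ?thesis by blast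
qed

lemma measurable_\<mu> [measurable]: "\<mu> \<in> borel_measurable L"
  by (intro continuous_imp_measurable_on_sets_lebesgue \<mu>_cont) auto

lemma measurable_U [measurable]: "U \<in> borel_measurable L"
  by (intro continuous_imp_measurable_on_sets_lebesgue continuous_at_imp_continuous_on)
     (auto intro: DERIV_isCont U_deriv)

lemma measurable_H [measurable]: "(\<lambda>x. H x n) \<in> borel_measurable L"
  unfolding H_kern by measurable

text \<open>
  As \<open>\<delta> = \<plusminus>1\<close>, the map \<open>x \<mapsto> c U(x)\<^sup>\<delta>\<close> is a bijection of the half-line with derivative of absolute
  value \<open>c U(x)\<^sup>\<delta>\<^sup>-\<^sup>1 \<mu>(x)\<close>, increasing or decreasing according to the sign of \<open>\<delta>\<close>; surjectivity is where
  the divergence of the integral of \<open>\<mu>\<close> enters.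
\<close>

lemma substitution_U:
  fixes F :: "real \<Rightarrow> real"
  assumes c: "c > 0" and [measurable]: "F \<in> borel_measurable borel"
    and nonneg: "\<And>t. t > 0 \<Longrightarrow> F t \<ge> 0"
    and fin: "(\<integral>\<^sup>+t\<in>{0<..}. ennreal (F t) \<partial>lborel) < \<infinity>"
  shows "(\<integral>\<^sup>+x. ennreal (c * U x powr (\<delta> - 1) * \<mu> x * F (c * U x powr \<delta>)) \<partial>L)
    = (\<integral>\<^sup>+t\<in>{0<..}. ennreal (F t) \<partial>lborel)"
proof -
  define g where "g = (\<lambda>x. c * U x powr \<delta>)"
  define g' where "g' = (\<lambda>x. c * (\<delta> * U x powr (\<delta> - 1) * \<mu> x))"
  have "set_integrable lborel {0<..} F"
    unfolding set_integrable_def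
  proof (rule integrableI_bounded)
    have "(\<integral>\<^sup>+x. ennreal (norm (indicator {0<..} x *\<^sub>R F x)) \<partial>lborel)
        = (\<integral>\<^sup>+t\<in>{0<..}. ennreal (F t) \<partial>lborel)"
      by (intro nn_integral_cong) (auto simp: indicator_def nonneg)
    then show "(\<integral>\<^sup>+x. ennreal (norm (indicator {0<..} x *\<^sub>R F x)) \<partial>lborel) < \<infinity>" using fin by simp
  qed measurable
  then have absF: "F absolutely_integrable_on {0<..}"
    unfolding set_integrable_def by (simp add: integrable_completion)
  have g_pos: "g x > 0" if "x > 0" for x using U_pos[OF that] c by (simp add: g_def)
  have image: "g ` {0<..} = {0<..}"
  proof (intro equalityI subsetI)
    fix y :: real assume "y \<in> {0<..}"
    then have "(y / c) powr (1 / \<delta>) > 0" using c by simp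
    then obtain x where "x > 0" "U x = (y / c) powr (1 / \<delta>)" by (rule U_image)
    then have "x > 0" "g x = y"
      using c \<delta> \<open>y \<in> {0<..}\<close> by (auto simp: g_def powr_powr)
    then show "y \<in> g ` {0<..}" by auto
  qed (auto simp: g_pos)
  have "inj_on g {0<..}"
  proof (rule inj_onI)
    fix x y assume xy: "x \<in> {0<..}" "y \<in> {0<..}" "g x = g y"
    then have "(U x powr \<delta>) powr (1 / \<delta>) = (U y powr \<delta>) powr (1 / \<delta>)" using c by (simp add: g_def)
    then have "U x = U y" using U_pos[of x] U_pos[of y] xy \<delta> by (auto simp: powr_powr)
    then show "x = y" using U_strict_mono[of x y] U_strict_mono[of y x] xy by force
  qed
  moreover have "(g has_real_derivative g' x) (at x within {0<..})" if x: "x \<in> {0<..}" for x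
  proof (rule has_field_derivative_at_within)
    show "(g has_real_derivative g' x) (at x)"
      unfolding g_def g'_def using x U_pos[of x] U_deriv[of x]
      by (auto intro!: derivative_eq_intros DERIV_fun_powr)
  qed
  ultimately have "(\<lambda>x. \<bar>g' x\<bar> * F (g x)) absolutely_integrable_on {0<..} \<and>
      integral {0<..} (\<lambda>x. \<bar>g' x\<bar> * F (g x)) = integral {0<..} F"
    using has_absolute_integral_change_of_variables_1'[of "{0<..}" g g' F "integral {0<..} F"] image absF
    by simp
  then have int: "((\<lambda>x. \<bar>g' x\<bar> * F (g x)) has_integral integral {0<..} F) {0<..}"
    by (metis absolutely_integrable_on_def integrable_integral)
  have "(\<integral>\<^sup>+t\<in>{0<..}. ennreal (F t) \<partial>lborel) = ennreal (integral {0<..} F)"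
    using absF nonneg unfolding absolutely_integrable_on_def
    by (intro nn_integral_has_integral_lebesgue' integrable_integral) auto
  moreover have "(\<integral>\<^sup>+x\<in>{0<..}. ennreal (\<bar>g' x\<bar> * F (g x)) \<partial>lborel) = ennreal (integral {0<..} F)"
    by (intro nn_integral_has_integral_lebesgue' int)
       (auto simp: nonneg g_pos)
  moreover have "(\<integral>\<^sup>+x. ennreal (c * U x powr (\<delta> - 1) * \<mu> x * F (c * U x powr \<delta>)) \<partial>L)
      = (\<integral>\<^sup>+x\<in>{0<..}. ennreal (\<bar>g' x\<bar> * F (g x)) \<partial>lborel)"
    unfolding nn_integral_L[symmetric] nn_integral_completion
  proof (rule nn_integral_cong)
    fix x :: real
    have "\<bar>g' x\<bar> = c * U x powr (\<delta> - 1) * \<mu> x" if "x > 0"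
      using c \<delta> \<mu>_pos[OF that] by (auto simp: g'_def abs_mult)
    then show "ennreal (c * U x powr (\<delta> - 1) * \<mu> x * F (c * U x powr \<delta>)) * indicator {0<..} x
        = ennreal (\<bar>g' x\<bar> * F (g x)) * indicator {0<..} x"
      by (simp add: indicator_def g_def)
  qed
  ultimately show ?thesis by simp
qed

section \<open>The two weights\<close>

lemma partial_sum_Suc: "V (Suc n) = V n + \<nu> (Suc n)"
  by (simp add: partial_sum_def)

lemma V_nonneg: "V n \<ge> 0"
  unfolding partial_sum_def by (intro sum_nonneg) (simp add: less_imp_le \<nu>_pos)

lemma V_mono: "m \<le> n \<Longrightarrow> V m \<le> V n"
proof (induction n rule: dec_induct)
  case (step n)
  then show ?case using \<nu>_pos[of "Suc n"] by (simp add: partial_sum_Suc)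
qed simp

lemma V_pos: "V (Suc n) > 0"
  using V_nonneg[of n] \<nu>_pos[of "Suc n"] by (simp add: partial_sum_Suc)

text \<open>
  The bound on \<open>\<nu>t\<close> says exactly that \<open>W\<close> does not fall below the midpoint of its cell.
\<close>

lemma W_ge_midpoint: "V n + \<nu> (Suc n) / 2 \<le> W (Suc n)"
  using \<nu>t[of "Suc n"] by (simp add: V_tilde_def partial_sum_Suc)

lemma W_le: "W (Suc n) \<le> V (Suc n)"
  using \<nu>t[of "Suc n"] by (simp add: V_tilde_def)

lemma W_pos: "W (Suc n) > 0"
  using W_ge_midpoint[of n] V_nonneg[of n] \<nu>_pos[of "Suc n"] by simp

lemma H_pos: "x > 0 \<Longrightarrow> H x (Suc n) > 0"
  using U_pos[of x] W_pos[of n] by (simp add: H_kern kern_pos)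

text \<open>
  The factor \<open>\<mu>(x) U(x)\<^sup>\<delta>\<^sup>s\<^sup>-\<^sup>1\<close> is what the substitution \<open>t = W\<^sub>n U(x)\<^sup>\<delta>\<close> turns into \<open>t\<^sup>s\<^sup>-\<^sup>1 dt\<close>, up to the
  constant power of \<open>W\<^sub>n\<close>.  The exponents \<open>s \<noteq> \<sigma>\<close> serve the test functions.
\<close>

lemma weight_n:
  assumes s: "s > \<gamma>"
  shows "(\<integral>\<^sup>+x. ennreal (H x (Suc n) * (\<mu> x * U x powr (\<delta> * s - 1))) \<partial>L)
    = ennreal (W (Suc n) powr - s) * k s"
proof -
  define c where "c = W (Suc n)"
  have c: "c > 0" by (simp add: c_def W_pos)
  have "(\<integral>\<^sup>+x. ennreal (H x (Suc n) * (\<mu> x * U x powr (\<delta> * s - 1))) \<partial>L)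
    = (\<integral>\<^sup>+x. ennreal (c powr - s) * ennreal (c * U x powr (\<delta> - 1) * \<mu> x
        * (K (c * U x powr \<delta>) * (c * U x powr \<delta>) powr (s - 1))) \<partial>L)"
  proof (rule nn_integral_cong)
    fix x assume "x \<in> space L"
    then have x: "x > 0" by simp
    note u = U_pos[OF x]
    have "c powr - s * (c * U x powr (\<delta> - 1) * \<mu> x
        * (K (c * U x powr \<delta>) * (c * U x powr \<delta>) powr (s - 1)))
      = (c powr - s * c * c powr (s - 1)) * (U x powr (\<delta> - 1) * U x powr (\<delta> * (s - 1)))
        * (\<mu> x * K (c * U x powr \<delta>))"
      using c u by (simp add: powr_mult powr_powr)
    also have "c powr - s * c * c powr (s - 1) = 1"
      using c by (simp add: powr_diff powr_minus)
    also have "U x powr (\<delta> - 1) * U x powr (\<delta> * (s - 1)) = U x powr (\<delta> * s - 1)"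
      by (simp add: algebra_simps flip: powr_add)
    finally have eq: "c powr - s * (c * U x powr (\<delta> - 1) * \<mu> x
        * (K (c * U x powr \<delta>) * (c * U x powr \<delta>) powr (s - 1)))
        = H x (Suc n) * (\<mu> x * U x powr (\<delta> * s - 1))"
      by (simp add: H_kern c_def mult_ac)
    show "ennreal (H x (Suc n) * (\<mu> x * U x powr (\<delta> * s - 1)))
      = ennreal (c powr - s) * ennreal (c * U x powr (\<delta> - 1) * \<mu> x
        * (K (c * U x powr \<delta>) * (c * U x powr \<delta>) powr (s - 1)))"
      by (simp only: ennreal_mult'[symmetric, OF powr_ge_zero] eq)
  qed
  also have "\<dots> = ennreal (c powr - s) * (\<integral>\<^sup>+x. ennreal (c * U x powr (\<delta> - 1) * \<mu> x
        * (K (c * U x powr \<delta>) * (c * U x powr \<delta>) powr (s - 1))) \<partial>L)"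
    by (rule nn_integral_cmult) measurable
  also have "(\<integral>\<^sup>+x. ennreal (c * U x powr (\<delta> - 1) * \<mu> x
        * (K (c * U x powr \<delta>) * (c * U x powr \<delta>) powr (s - 1))) \<partial>L) = k s"
    unfolding k_const_kern
    using k_finite[OF s] kern_pos c
    by (intro substitution_U[of c "\<lambda>t. K t * t powr (s - 1)"]) (auto simp: k_const_kern less_imp_le)
  finally show ?thesis by (simp add: c_def)
qed

text \<open>
  With \<open>u = U(x)\<^sup>\<delta>\<close> and \<open>h(v) = K(u v) (u v)\<^sup>\<sigma>\<^sup>-\<^sup>1\<close>, each summand is, up to \<open>u\<^sup>1\<^sup>-\<^sup>\<sigma>\<close>, the product of the
  cell length \<open>\<nu>\<^sub>n\<close> with a value of \<open>h\<close>, a decreasing function, at or beyond the midpoint.  The strict midpoint rule bounds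
  it by the integral of \<open>h\<close> over the cell, and the cells are disjoint subsets of the half-line.
\<close>

lemma weight_x:
  assumes x: "x > 0"
  shows "(\<Sum>n. ennreal (H x (Suc n) * (\<nu> (Suc n) * W (Suc n) powr (\<sigma> - 1))))
    < ennreal (U x powr (- \<delta> * \<sigma>)) * k \<sigma>"
proof -
  define u where "u = U x powr \<delta>"
  define h where "h = (\<lambda>v. K (u * v) * (u * v) powr (\<sigma> - 1))"
  have u: "u > 0" using U_pos[OF x] by (simp add: u_def)
  have [measurable]: "h \<in> borel_measurable borel" unfolding h_def by measurable
  have h_nonneg: "h v \<ge> 0" if "v > 0" for v
    using kern_pos[of "u * v"] that u by (simp add: h_def)
  have scale: "ennreal u * (\<integral>\<^sup>+v\<in>{0<..}. ennreal (h v) \<partial>lborel) = k \<sigma>"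
    unfolding k_const_kern using u
    by (subst (2) nn_integral_real_affine[where c = u and t = 0])
       (auto intro!: arg_cong[where f = "\<lambda>x. ennreal u * x"] nn_integral_cong
         simp: h_def indicator_def zero_less_mult_iff)
  have cell: "ennreal (\<nu> (Suc n) * h (W (Suc n))) < (\<integral>\<^sup>+v\<in>{V n<..<V (Suc n)}. ennreal (h v) \<partial>lborel)" for n
  proof -
    define m r where "m = V n + \<nu> (Suc n) / 2" and "r = \<nu> (Suc n) / 2"
    have m: "0 < r" "r \<le> m" "m \<le> W (Suc n)"
      using \<nu>_pos[of "Suc n"] V_nonneg[of n] W_ge_midpoint[of n] by (auto simp: m_def r_def)
    have "h (W (Suc n)) \<le> h m"
      unfolding h_def
    proof (rule mult_mono)
      show "K (u * W (Suc n)) \<le> K (u * m)"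
        using kern_strict_antimono[of "u * m" "u * W (Suc n)"] m u
        by (cases "m = W (Suc n)") auto
      show "(u * W (Suc n)) powr (\<sigma> - 1) \<le> (u * m) powr (\<sigma> - 1)"
        using m u \<sigma> by (intro powr_mono2') auto
    qed (use m u kern_pos[of "u * m"] in auto)
    then have "ennreal (\<nu> (Suc n) * h (W (Suc n))) \<le> ennreal (2 * r * h m)"
      using m by (intro ennreal_leI) (simp add: r_def)
    also have "\<dots> < (\<integral>\<^sup>+v\<in>{m - r<..<m + r}. ennreal (h v) \<partial>lborel)"
    proof (rule midpoint_rule_strict)
      fix s assume s: "0 < s" "s < r"
      show "2 * h m < h (m + s) + h (m - s)"
        using kern_powr_midpoint_strict[of "u * s" "u * m" \<sigma>] s m u \<sigma>
        by (simp add: h_def algebra_simps)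
    qed (use m h_nonneg in auto)
    also have "{m - r<..<m + r} = {V n<..<V (Suc n)}" by (simp add: m_def r_def partial_sum_Suc add.commute)
    finally show ?thesis .
  qed
  have cells: "(\<Sum>n. (\<integral>\<^sup>+v\<in>{V n<..<V (Suc n)}. ennreal (h v) \<partial>lborel))
      \<le> (\<integral>\<^sup>+v\<in>{0<..}. ennreal (h v) \<partial>lborel)"
  proof -
    have "disjoint_family (\<lambda>n. {V n<..<V (Suc n)})"
      unfolding disjoint_family_on_def
    proof safe
      fix i j v assume "i \<noteq> j" and v: "v \<in> {V i<..<V (Suc i)}" "v \<in> {V j<..<V (Suc j)}"
      then consider "Suc i \<le> j" | "Suc j \<le> i" by linarith
      then show "v \<in> {}" using V_mono v by cases (force dest: V_mono)+
    qed
    then have "(\<Sum>n. (\<integral>\<^sup>+v\<in>{V n<..<V (Suc n)}. ennreal (h v) \<partial>lborel))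
      = (\<integral>\<^sup>+v\<in>(\<Union>n. {V n<..<V (Suc n)}). ennreal (h v) \<partial>lborel)"
      by (intro nn_integral_disjoint_family[symmetric]) auto
    also have "\<dots> \<le> (\<integral>\<^sup>+v\<in>{0<..}. ennreal (h v) \<partial>lborel)"
      using V_nonneg by (intro nn_integral_mono) (auto simp: indicator_def intro: le_less_trans)
    finally show ?thesis .
  qed
  have fin: "(\<integral>\<^sup>+v\<in>{0<..}. ennreal (h v) \<partial>lborel) < \<infinity>"
    using k_finite[OF \<sigma>(1)] u unfolding scale[symmetric] by (auto simp: ennreal_mult_less_top)
  have "(\<Sum>n. ennreal (\<nu> (Suc n) * h (W (Suc n))))
      < (\<Sum>n. (\<integral>\<^sup>+v\<in>{V n<..<V (Suc n)}. ennreal (h v) \<partial>lborel))"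
  proof (rule suminf_strict_mono_ennreal[OF _ cell])
    have "(\<Sum>n. ennreal (\<nu> (Suc n) * h (W (Suc n)))) 
        \<le> (\<Sum>n. (\<integral>\<^sup>+v\<in>{V n<..<V (Suc n)}. ennreal (h v) \<partial>lborel))"
      by (intro suminf_le less_imp_le[OF cell]) auto
    then show "(\<Sum>n. ennreal (\<nu> (Suc n) * h (W (Suc n)))) < \<infinity>" using cells fin by auto
  qed
  also note cells
  finally have "ennreal (u powr (1 - \<sigma>)) * (\<Sum>n. ennreal (\<nu> (Suc n) * h (W (Suc n))))
      < ennreal (u powr (1 - \<sigma>)) * (\<integral>\<^sup>+v\<in>{0<..}. ennreal (h v) \<partial>lborel)"
    using u by (intro ennreal_mult_strict_left_mono) auto
  also have "ennreal (u powr (1 - \<sigma>)) = ennreal (u powr - \<sigma>) * ennreal u"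
    using u by (simp add: powr_diff powr_minus divide_inverse mult.commute flip: ennreal_mult')
  also have "\<dots> * (\<integral>\<^sup>+v\<in>{0<..}. ennreal (h v) \<partial>lborel) = ennreal (u powr - \<sigma>) * k \<sigma>"
    by (simp add: mult.assoc scale)
  also have "ennreal (u powr - \<sigma>) * ennreal u * (\<Sum>n. ennreal (\<nu> (Suc n) * h (W (Suc n))))
      = (\<Sum>n. ennreal (u powr - \<sigma> * u * (\<nu> (Suc n) * h (W (Suc n)))))"
    using u by (simp add: ennreal_mult' mult.assoc)
  also have "\<dots> = (\<Sum>n. ennreal (H x (Suc n) * (\<nu> (Suc n) * W (Suc n) powr (\<sigma> - 1))))"
  proof (intro suminf_cong arg_cong[where f = ennreal])
    fix n
    have "u powr - \<sigma> * u * u powr (\<sigma> - 1) = 1" using u by (simp add: powr_diff powr_minus)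
    then show "u powr - \<sigma> * u * (\<nu> (Suc n) * h (W (Suc n)))
        = H x (Suc n) * (\<nu> (Suc n) * W (Suc n) powr (\<sigma> - 1))"
      using u W_pos[of n] by (simp add: h_def H_kern powr_mult flip: u_def)
  qed
  also have "u powr - \<sigma> = U x powr (- \<delta> * \<sigma>)" by (simp add: u_def powr_powr)
  finally show ?thesis .
qed

end

section \<open>The series and the integral inequality\<close>

context half_discrete
begin

definition \<kappa> :: real where "\<kappa> = enn2real (k \<sigma>)"

lemma k_eq: "k \<sigma> = ennreal \<kappa>" and \<kappa>_pos: "\<kappa> > 0"
  using k_finite[OF \<sigma>(1)] k_pos[of \<sigma>] by (auto simp: \<kappa>_def enn2real_positive_iff)

lemma Phi_pos: "x > 0 \<Longrightarrow> Phi p \<delta> \<sigma> \<mu> x > 0"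
  using U_pos[of x] \<mu>_pos[of x] by (simp add: Phi_def)

lemma measurable_Phi [measurable]: "Phi p \<delta> \<sigma> \<mu> \<in> borel_measurable L"
  unfolding Phi_def[abs_def] by measurable

text \<open>
  The quantities under the outer root of the two norms.  Since the root has a nonzero exponent, a norm
  is positive and finite exactly when its mass is, which frees the proofs from the outer power.
\<close>

definition mass_f :: "(real \<Rightarrow> real) \<Rightarrow> ennreal" where
  "mass_f f = (\<integral>\<^sup>+x. ennreal (Phi p \<delta> \<sigma> \<mu> x) * ennreal (f x) epowr p \<partial>L)"

definition mass_a :: "(nat \<Rightarrow> real) \<Rightarrow> ennreal" where
  "mass_a a = (\<Sum>n. ennreal (Psi_tilde q \<sigma> \<nu> \<nu>t (Suc n)) * ennreal (a (Suc n)) epowr q)"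

lemma norm_f_mass: "norm_f p \<delta> \<sigma> \<mu> f = mass_f f epowr (1 / p)"
  by (simp add: norm_f_def mass_f_def nn_integral_L)

lemma norm_a_mass: "norm_a q \<sigma> \<nu> \<nu>t a = mass_a a epowr (1 / q)"
  by (simp add: norm_a_def mass_a_def)

lemma admissible_f_iff:
  "admissible_f p \<delta> \<sigma> \<mu> f \<longleftrightarrow>
    f \<in> borel_measurable L \<and> (\<forall>x>0. f x \<ge> 0) \<and> 0 < mass_f f \<and> mass_f f < \<infinity>"
  unfolding admissible_f_def norm_f_mass using epowr_pos_finite_iff[of "1 / p" "mass_f f"] p by auto

lemma admissible_a_iff:
  "admissible_a q \<sigma> \<nu> \<nu>t a \<longleftrightarrow> (\<forall>n\<ge>1. a n \<ge> 0) \<and> 0 < mass_a a \<and> mass_a a < \<infinity>"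
  unfolding admissible_a_def norm_a_mass using epowr_pos_finite_iff[of "1 / q" "mass_a a"] q(1) by auto

text \<open>
  Jensen with density \<open>H w\<close>, \<open>w = \<mu> U\<^sup>\<delta>\<^sup>\<sigma>\<^sup>-\<^sup>1\<close>, whose mass is known exactly from the weight in \<open>n\<close>, bounds the
  \<open>p\<close>-th power of each inner integral from above.  After summation the weight \<open>\<omega>(x)\<close> appears under
  the integral and is strictly below \<open>\<kappa> U\<^sup>-\<^sup>\<delta>\<^sup>\<sigma>\<close>.  The last root has the negative exponent \<open>1/p\<close> and
  reverses the inequality.
\<close>

theorem ineq_series_k: "ineq_series \<alpha> \<rho> \<gamma> \<sigma> \<delta> p \<mu> \<nu> \<nu>t (k \<sigma>)"
  unfolding ineq_series_def nn_integral_L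
proof (intro allI impI)
  fix f assume "admissible_f p \<delta> \<sigma> \<mu> f"
  then have [measurable]: "f \<in> borel_measurable L" and mass: "mass_f f < \<infinity>"
    by (auto simp: admissible_f_iff)
  define w where "w = (\<lambda>x. \<mu> x * U x powr (\<delta> * \<sigma> - 1))"
  have w_pos: "w x > 0" if "x > 0" for x using that \<mu>_pos U_pos[OF that] by (simp add: w_def)
  have [measurable]: "w \<in> borel_measurable L" unfolding w_def by measurable
  define fp where "fp = (\<lambda>x. ennreal (w x * (1 / w x) powr p) * ennreal (f x) epowr p)"
  have [measurable]: "fp \<in> borel_measurable L" unfolding fp_def by measurable
  define F where "F = (\<lambda>n. \<integral>\<^sup>+x. ennreal (H x (Suc n) * f x) \<partial>L)"
  define b where "b = (\<lambda>n. \<nu> (Suc n) * W (Suc n) powr (\<sigma> - 1))"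
  have b_pos: "b n > 0" for n using \<nu>_pos[of "Suc n"] W_pos[of n] by (simp add: b_def)
  have F_le: "ennreal (\<nu> (Suc n) / W (Suc n) powr (1 - p * \<sigma>)) * F n epowr p
    \<le> (\<integral>\<^sup>+x. ennreal (\<kappa> powr (p - 1)) * (ennreal (H x (Suc n) * b n) * fp x) \<partial>L)" for n
  proof -
    have F_eq: "F n = (\<integral>\<^sup>+x. ennreal (H x (Suc n) * w x) * ennreal (f x / w x) \<partial>L)"
      unfolding F_def
    proof (rule nn_integral_cong)
      fix x assume "x \<in> space L"
      then show "ennreal (H x (Suc n) * f x) = ennreal (H x (Suc n) * w x) * ennreal (f x / w x)"
        using w_pos[of x] H_pos[of x n] by (simp flip: ennreal_mult')
    qed
    have "F n epowr p \<le> ennreal ((W (Suc n) powr - \<sigma> * \<kappa>) powr (p - 1))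
        * (\<integral>\<^sup>+x. ennreal (H x (Suc n) * w x) * ennreal (f x / w x) epowr p \<partial>L)"
      unfolding F_eq
    proof (rule jensen_negative_exponent[OF _ _ _ p pq])
      show "(\<integral>\<^sup>+x. ennreal (H x (Suc n) * w x) \<partial>L) = ennreal (W (Suc n) powr - \<sigma> * \<kappa>)"
        using weight_n[OF \<sigma>(1), of n] \<kappa>_pos by (simp add: w_def k_eq ennreal_mult)
      show "0 < H x (Suc n) * w x" if "x \<in> space L" for x
        using that H_pos[of x n] w_pos[of x] by simp
      show "0 < W (Suc n) powr - \<sigma> * \<kappa>" using W_pos[of n] \<kappa>_pos by simp
    qed measurable
    also have "(\<integral>\<^sup>+x. ennreal (H x (Suc n) * w x) * ennreal (f x / w x) epowr p \<partial>L)
        = (\<integral>\<^sup>+x. ennreal (H x (Suc n)) * fp x \<partial>L)"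
    proof (rule nn_integral_cong)
      fix x assume "x \<in> space L"
      then have x: "x > 0" by simp
      have "ennreal (f x / w x) = ennreal (1 / w x) * ennreal (f x)"
        using w_pos[OF x] by (simp flip: ennreal_mult')
      then have "ennreal (f x / w x) epowr p = ennreal ((1 / w x) powr p) * ennreal (f x) epowr p"
        using w_pos[OF x] by (simp add: epowr_cmult)
      then show "ennreal (H x (Suc n) * w x) * ennreal (f x / w x) epowr p = ennreal (H x (Suc n)) * fp x"
        using w_pos[OF x] H_pos[OF x, of n] by (simp add: fp_def ennreal_mult' mult.assoc)
    qed
    finally have "ennreal (\<nu> (Suc n) / W (Suc n) powr (1 - p * \<sigma>)) * F n epowr p
      \<le> ennreal (\<nu> (Suc n) / W (Suc n) powr (1 - p * \<sigma>))
        * (ennreal ((W (Suc n) powr - \<sigma> * \<kappa>) powr (p - 1)) * (\<integral>\<^sup>+x. ennreal (H x (Suc n)) * fp x \<partial>L))"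
      by (rule mult_left_mono) simp
    also have "\<dots> = ennreal (\<kappa> powr (p - 1) * b n) * (\<integral>\<^sup>+x. ennreal (H x (Suc n)) * fp x \<partial>L)"
    proof -
      have "\<nu> (Suc n) / W (Suc n) powr (1 - p * \<sigma>) * (W (Suc n) powr - \<sigma> * \<kappa>) powr (p - 1)
        = \<kappa> powr (p - 1) * (\<nu> (Suc n) * (W (Suc n) powr (p * \<sigma> - 1) * W (Suc n) powr (- \<sigma> * (p - 1))))"
        using powr_minus_divide[of "W (Suc n)" "1 - p * \<sigma>"] \<kappa>_pos by (simp add: powr_mult powr_powr)
      also have "W (Suc n) powr (p * \<sigma> - 1) * W (Suc n) powr (- \<sigma> * (p - 1)) = W (Suc n) powr (\<sigma> - 1)"
        by (simp add: algebra_simps flip: powr_add)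
      finally have "ennreal (\<nu> (Suc n) / W (Suc n) powr (1 - p * \<sigma>))
          * ennreal ((W (Suc n) powr - \<sigma> * \<kappa>) powr (p - 1)) = ennreal (\<kappa> powr (p - 1) * b n)"
        unfolding b_def by (simp only: ennreal_mult''[OF powr_ge_zero, symmetric])
      then show ?thesis by (simp only: mult.assoc[symmetric])
    qed
    also have "\<dots> = (\<integral>\<^sup>+x. ennreal (\<kappa> powr (p - 1) * b n) * (ennreal (H x (Suc n)) * fp x) \<partial>L)"
      by (rule nn_integral_cmult[symmetric]) measurable
    also have "\<dots> = (\<integral>\<^sup>+x. ennreal (\<kappa> powr (p - 1)) * (ennreal (H x (Suc n) * b n) * fp x) \<partial>L)"
    proof (rule nn_integral_cong)
      fix x assume "x \<in> space L"
      then show "ennreal (\<kappa> powr (p - 1) * b n) * (ennreal (H x (Suc n)) * fp x)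
          = ennreal (\<kappa> powr (p - 1)) * (ennreal (H x (Suc n) * b n) * fp x)"
        using b_pos[of n] H_pos[of x n] by (simp add: ennreal_mult less_imp_le mult_ac)
    qed
    finally show ?thesis .
  qed
  have Phi_fp: "ennreal (\<kappa> powr (p - 1)) * (ennreal (U x powr (- \<delta> * \<sigma>)) * k \<sigma> * fp x)
      = ennreal (\<kappa> powr p) * (ennreal (Phi p \<delta> \<sigma> \<mu> x) * ennreal (f x) epowr p)" if x: "x > 0" for x
  proof -
    have "w x * (1 / w x) powr p = w x powr (1 - p)"
      using w_pos[OF x] by (simp add: powr_diff powr_divide)
    also have "\<dots> = \<mu> x powr (1 - p) * U x powr ((\<delta> * \<sigma> - 1) * (1 - p))"
      using \<mu>_pos[OF x] by (simp add: w_def powr_mult powr_powr)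
    also have "U x powr (- \<delta> * \<sigma>) * \<dots>
        = \<mu> x powr (1 - p) * (U x powr (- \<delta> * \<sigma>) * U x powr ((\<delta> * \<sigma> - 1) * (1 - p)))" by simp
    also have "U x powr (- \<delta> * \<sigma>) * U x powr ((\<delta> * \<sigma> - 1) * (1 - p)) = U x powr (p * (1 - \<delta> * \<sigma>) - 1)"
      by (simp add: algebra_simps flip: powr_add)
    also have "\<mu> x powr (1 - p) = 1 / \<mu> x powr (p - 1)"
      using powr_minus_divide[of "\<mu> x" "p - 1"] by simp
    finally have *: "U x powr (- \<delta> * \<sigma>) * (w x * (1 / w x) powr p) = Phi p \<delta> \<sigma> \<mu> x"
      by (simp add: Phi_def)
    have "\<kappa> powr (p - 1) * \<kappa> = \<kappa> powr p" using \<kappa>_pos by (simp add: powr_diff)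
    then have "\<kappa> powr (p - 1) * (U x powr (- \<delta> * \<sigma>) * \<kappa> * (w x * (1 / w x) powr p))
        = \<kappa> powr p * Phi p \<delta> \<sigma> \<mu> x"
      unfolding *[symmetric] by (metis mult.assoc mult.commute)
    then have "ennreal (\<kappa> powr (p - 1)) * (ennreal (U x powr (- \<delta> * \<sigma>)) * ennreal \<kappa> * ennreal (w x * (1 / w x) powr p))
        = ennreal (\<kappa> powr p) * ennreal (Phi p \<delta> \<sigma> \<mu> x)"
      using \<kappa>_pos w_pos[OF x] by (simp add: less_imp_le flip: ennreal_mult')
    then show ?thesis by (simp only: k_eq fp_def mult.assoc[symmetric])
  qed
  have upper_fin: "(\<integral>\<^sup>+x. ennreal (\<kappa> powr p) * (ennreal (Phi p \<delta> \<sigma> \<mu> x) * ennreal (f x) epowr p) \<partial>L)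
      = ennreal (\<kappa> powr p) * mass_f f"
    unfolding mass_f_def by (rule nn_integral_cmult) measurable
  define \<omega> where "\<omega> = (\<lambda>x. \<Sum>n. ennreal (H x (Suc n) * b n))"
  have \<omega>_less: "\<omega> x < ennreal (U x powr (- \<delta> * \<sigma>)) * k \<sigma>" if "x > 0" for x
    using weight_x[OF that] by (simp add: \<omega>_def b_def)
  have [measurable]: "\<omega> \<in> borel_measurable L" unfolding \<omega>_def by measurable
  have le: "ennreal (\<kappa> powr (p - 1)) * (\<omega> x * fp x)
      \<le> ennreal (\<kappa> powr p) * (ennreal (Phi p \<delta> \<sigma> \<mu> x) * ennreal (f x) epowr p)" if "x > 0" for x
    unfolding Phi_fp[OF that, symmetric] by (intro mult_left_mono mult_right_mono less_imp_le[OF \<omega>_less] that) auto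
  have "(\<Sum>n. ennreal (\<nu> (Suc n) / W (Suc n) powr (1 - p * \<sigma>)) * F n epowr p)
      \<le> (\<Sum>n. \<integral>\<^sup>+x. ennreal (\<kappa> powr (p - 1)) * (ennreal (H x (Suc n) * b n) * fp x) \<partial>L)"
    by (intro suminf_le F_le) auto
  also have "\<dots> = (\<integral>\<^sup>+x. (\<Sum>n. ennreal (\<kappa> powr (p - 1)) * (ennreal (H x (Suc n) * b n) * fp x)) \<partial>L)"
    by (rule nn_integral_suminf[symmetric]) measurable
  also have "\<dots> = (\<integral>\<^sup>+x. ennreal (\<kappa> powr (p - 1)) * (\<omega> x * fp x) \<partial>L)"
    by (simp add: \<omega>_def)
  also have "\<dots> < (\<integral>\<^sup>+x. ennreal (\<kappa> powr p) * (ennreal (Phi p \<delta> \<sigma> \<mu> x) * ennreal (f x) epowr p) \<partial>L)"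
  proof (rule nn_integral_strict_mono[where S = "{0<..}"])
    show "(\<integral>\<^sup>+x. ennreal (\<kappa> powr (p - 1)) * (\<omega> x * fp x) \<partial>L) < \<infinity>"
    proof (rule le_less_trans)
      show "(\<integral>\<^sup>+x. ennreal (\<kappa> powr (p - 1)) * (\<omega> x * fp x) \<partial>L) \<le> ennreal (\<kappa> powr p) * mass_f f"
        unfolding upper_fin[symmetric] by (intro nn_integral_mono le) simp
    qed (use mass in \<open>simp add: ennreal_mult_less_top\<close>)
    show "AE x in L. ennreal (\<kappa> powr (p - 1)) * (\<omega> x * fp x)
      \<le> ennreal (\<kappa> powr p) * (ennreal (Phi p \<delta> \<sigma> \<mu> x) * ennreal (f x) epowr p)"
      by (intro AE_I2 le) simp
    have "AE x in L. ennreal (Phi p \<delta> \<sigma> \<mu> x) * ennreal (f x) epowr p \<noteq> \<infinity>"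
      using mass by (intro nn_integral_PInf_AE) (auto simp: mass_f_def)
    then show "AE x in L. x \<in> {0<..} \<longrightarrow> ennreal (\<kappa> powr (p - 1)) * (\<omega> x * fp x)
      < ennreal (\<kappa> powr p) * (ennreal (Phi p \<delta> \<sigma> \<mu> x) * ennreal (f x) epowr p)"
    proof eventually_elim
      case (elim x)
      show ?case
      proof
        assume "x \<in> {0<..}"
        then have x: "x > 0" by simp
        have "ennreal (f x) epowr p \<noteq> \<infinity>" using elim Phi_pos[OF x] by (auto simp: ennreal_mult_eq_top_iff)
        moreover have "ennreal (f x) epowr p \<noteq> 0" using p by (simp add: epowr_eq_0_iff)
        ultimately have "fp x < \<infinity>" "fp x > 0"
          using w_pos[OF x] by (auto simp: fp_def ennreal_mult_less_top less_top zero_less_iff_neq_zero)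
        then have "\<omega> x * fp x < ennreal (U x powr (- \<delta> * \<sigma>)) * k \<sigma> * fp x"
          using \<omega>_less[OF x] by (intro ennreal_mult_strict_right_mono) auto
        then show "ennreal (\<kappa> powr (p - 1)) * (\<omega> x * fp x)
          < ennreal (\<kappa> powr p) * (ennreal (Phi p \<delta> \<sigma> \<mu> x) * ennreal (f x) epowr p)"
          unfolding Phi_fp[OF x, symmetric] using \<kappa>_pos by (intro ennreal_mult_strict_left_mono) auto
      qed
    qed
  qed (use emeasure_L in \<open>auto simp: sets_restrict_space\<close>)
  also note upper_fin
  finally have "(ennreal (\<kappa> powr p) * mass_f f) epowr (1 / p)
      < (\<Sum>n. ennreal (\<nu> (Suc n) / W (Suc n) powr (1 - p * \<sigma>)) * F n epowr p) epowr (1 / p)"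
    using p by (intro epowr_strict_antimono) auto
  moreover have "(ennreal (\<kappa> powr p) * mass_f f) epowr (1 / p) = k \<sigma> * norm_f p \<delta> \<sigma> \<mu> f"
    using \<kappa>_pos p by (simp add: epowr_cmult powr_powr k_eq norm_f_mass)
  ultimately show "k \<sigma> * norm_f p \<delta> \<sigma> \<mu> f
    < (\<Sum>n. ennreal (\<nu> (Suc n) / W (Suc n) powr (1 - p * \<sigma>))
        * (\<integral>\<^sup>+x. ennreal (H x (Suc n) * f x) \<partial>L) epowr p) epowr (1 / p)"
    by (simp add: F_def)
qed

text \<open>
  Jensen for the inner sum with weights \<open>H b\<^sub>n\<close>, \<open>b\<^sub>n = \<nu>\<^sub>n W\<^sub>n\<^sup>\<sigma>\<^sup>-\<^sup>1\<close>, of total mass \<open>c < \<kappa> U\<^sup>-\<^sup>\<delta>\<^sup>\<sigma>\<close>.  The mass enters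
  with the negative exponent \<open>q - 1\<close>, so its strict upper bound is a strict lower bound for the
  integrand; integrating in \<open>x\<close> then uses the exact weight in \<open>n\<close>.
\<close>

theorem ineq_integral_k: "ineq_integral \<alpha> \<rho> \<gamma> \<sigma> \<delta> q \<mu> \<nu> \<nu>t (k \<sigma>)"
  unfolding ineq_integral_def nn_integral_L
proof (intro allI impI)
  fix a assume "admissible_a q \<sigma> \<nu> \<nu>t a"
  then have mass: "mass_a a < \<infinity>" "mass_a a > 0"
    by (auto simp: admissible_a_iff)
  define b where "b = (\<lambda>n. \<nu> (Suc n) * W (Suc n) powr (\<sigma> - 1))"
  have b_pos: "b n > 0" for n using \<nu>_pos[of "Suc n"] W_pos[of n] by (simp add: b_def)
  define aq where "aq = (\<lambda>n. ennreal (b n powr (1 - q)) * ennreal (a (Suc n)) epowr q)"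
  define T where "T = (\<lambda>x. \<Sum>n. ennreal (H x (Suc n)) * aq n)"
  have [measurable]: "T \<in> borel_measurable L" unfolding T_def by measurable
  define G where "G = (\<lambda>x. \<Sum>n. ennreal (H x (Suc n) * a (Suc n)))"
  have [measurable]: "G \<in> borel_measurable L" unfolding G_def by measurable
  define w where "w = (\<lambda>x. \<mu> x * U x powr (\<delta> * \<sigma> - 1))"
  have w_pos: "w x > 0" if "x > 0" for x using that \<mu>_pos U_pos[OF that] by (simp add: w_def)
  have [measurable]: "w \<in> borel_measurable L" unfolding w_def by measurable
  define m where "m = (\<lambda>x. \<mu> x / U x powr (1 - q * \<delta> * \<sigma>))"
  have m_pos: "m x > 0" if "x > 0" for x using that \<mu>_pos U_pos[OF that] by (simp add: m_def)
  have [measurable]: "m \<in> borel_measurable L" unfolding m_def by measurable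
  have G_ge: "\<exists>c. 0 < c \<and> c < U x powr (- \<delta> * \<sigma>) * \<kappa> \<and> ennreal (c powr (q - 1)) * T x \<le> G x epowr q"
    if x: "x > 0" for x
  proof -
    define C where "C = (\<Sum>n. ennreal (H x (Suc n) * b n))"
    have C_less: "C < ennreal (U x powr (- \<delta> * \<sigma>) * \<kappa>)"
      using weight_x[OF x] \<kappa>_pos by (simp add: C_def b_def k_eq ennreal_mult)
    have "0 < ennreal (H x (Suc 0) * b 0)" using H_pos[OF x, of 0] b_pos[of 0] by simp
    also have "\<dots> \<le> C" unfolding C_def using sum_le_suminf[of "\<lambda>n. ennreal (H x (Suc n) * b n)" "{0}"] by simp
    finally have "C > 0" .
    with C_less obtain c where c: "C = ennreal c" "c > 0" by (cases C rule: ennreal_cases_pos) auto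
    have "ennreal (c powr (q - 1)) * (\<integral>\<^sup>+n. ennreal (H x (Suc n) * b n) * ennreal (a (Suc n) / b n) epowr q \<partial>count_space UNIV)
      \<le> (\<integral>\<^sup>+n. ennreal (H x (Suc n) * b n) * ennreal (a (Suc n) / b n) \<partial>count_space UNIV) epowr q"
    proof (rule jensen_fractional_exponent[OF _ _ _ p pq])
      show "0 < H x (Suc n) * b n" for n using H_pos[OF x, of n] b_pos[of n] by simp
      show "(\<integral>\<^sup>+n. ennreal (H x (Suc n) * b n) \<partial>count_space UNIV) = ennreal c"
        using c by (simp add: nn_integral_count_space_nat C_def)
    qed (use c in simp_all)
    also have "(\<integral>\<^sup>+n. ennreal (H x (Suc n) * b n) * ennreal (a (Suc n) / b n) \<partial>count_space UNIV) = G x"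
      unfolding nn_integral_count_space_nat G_def
    proof (rule suminf_cong)
      fix n show "ennreal (H x (Suc n) * b n) * ennreal (a (Suc n) / b n) = ennreal (H x (Suc n) * a (Suc n))"
        using b_pos[of n] H_pos[OF x, of n] by (simp flip: ennreal_mult')
    qed
    also have "(\<integral>\<^sup>+n. ennreal (H x (Suc n) * b n) * ennreal (a (Suc n) / b n) epowr q \<partial>count_space UNIV) = T x"
      unfolding nn_integral_count_space_nat T_def
    proof (rule suminf_cong)
      fix n
      have "ennreal (a (Suc n) / b n) = ennreal (1 / b n) * ennreal (a (Suc n))"
        using b_pos[of n] by (simp flip: ennreal_mult')
      then have 1: "ennreal (a (Suc n) / b n) epowr q = ennreal ((1 / b n) powr q) * ennreal (a (Suc n)) epowr q"
        using b_pos[of n] by (simp add: epowr_cmult)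
      have "b n * (1 / b n) powr q = b n powr (1 - q)"
        using b_pos[of n] by (simp add: powr_diff powr_divide)
      then have "ennreal (b n) * ennreal ((1 / b n) powr q) = ennreal (b n powr (1 - q))"
        using b_pos[of n] by (simp flip: ennreal_mult')
      then show "ennreal (H x (Suc n) * b n) * ennreal (a (Suc n) / b n) epowr q = ennreal (H x (Suc n)) * aq n"
        unfolding 1 aq_def using b_pos[of n] H_pos[OF x, of n] by (simp add: ennreal_mult' flip: mult.assoc) (simp add: mult.assoc)
    qed
    finally show ?thesis using c C_less \<kappa>_pos by (auto simp: ennreal_less_iff intro!: exI[of _ c])
  qed
  have lower_eq: "ennreal (m x) * (ennreal ((U x powr (- \<delta> * \<sigma>) * \<kappa>) powr (q - 1)) * T x)
      = ennreal (\<kappa> powr (q - 1)) * (ennreal (w x) * T x)" if x: "x > 0" for x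
  proof -
    have "m x * (U x powr (- \<delta> * \<sigma>) * \<kappa>) powr (q - 1)
       = \<kappa> powr (q - 1) * (\<mu> x * (U x powr (q * \<delta> * \<sigma> - 1) * U x powr (- \<delta> * \<sigma> * (q - 1))))"
      using powr_minus_divide[of "U x" "1 - q * \<delta> * \<sigma>"] \<kappa>_pos
      by (simp add: m_def powr_mult powr_powr)
    also have "U x powr (q * \<delta> * \<sigma> - 1) * U x powr (- \<delta> * \<sigma> * (q - 1)) = U x powr (\<delta> * \<sigma> - 1)"
      by (simp add: algebra_simps flip: powr_add)
    finally have "ennreal (m x) * ennreal ((U x powr (- \<delta> * \<sigma>) * \<kappa>) powr (q - 1))
        = ennreal (\<kappa> powr (q - 1)) * ennreal (w x)"
      using m_pos[OF x] w_pos[OF x] by (simp add: w_def flip: ennreal_mult')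
    then show ?thesis by (simp only: mult.assoc[symmetric])
  qed
  have less: "ennreal (\<kappa> powr (q - 1)) * (ennreal (w x) * T x) < ennreal (m x) * G x epowr q"
    if x: "x > 0" and T: "0 < T x" "T x < \<infinity>" for x
  proof -
    obtain c where c: "0 < c" "c < U x powr (- \<delta> * \<sigma>) * \<kappa>" "ennreal (c powr (q - 1)) * T x \<le> G x epowr q"
      using G_ge[OF x] by blast
    have "ennreal ((U x powr (- \<delta> * \<sigma>) * \<kappa>) powr (q - 1)) * T x < ennreal (c powr (q - 1)) * T x"
      using c q T by (intro ennreal_mult_strict_right_mono) (auto simp: ennreal_less_iff powr_less_mono2_neg)
    then show ?thesis unfolding lower_eq[OF x, symmetric]
      using c(3) m_pos[OF x] by (intro ennreal_mult_strict_left_mono) auto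
  qed
  have T_pos: "T x > 0" if x: "x > 0" for x
  proof (rule ccontr)
    assume "\<not> T x > 0"
    then have "T x = 0" by simp
    then have *: "ennreal (H x (Suc n)) * aq n = 0" for n unfolding T_def by (simp add: suminf_eq_zero_iff)
    have "aq n = 0" for n using *[of n] H_pos[OF x, of n] by (auto simp: ennreal_eq_0_iff)
    then have **: "ennreal (b n powr (1 - q)) * ennreal (a (Suc n)) epowr q = 0" for n
      by (simp add: aq_def)
    have "ennreal (a (Suc n)) epowr q = 0" for n using **[of n] b_pos[of n] by auto
    then have "mass_a a = 0" by (simp add: mass_a_def)
    with mass show False by simp
  qed
  have lower: "(\<integral>\<^sup>+x. ennreal (\<kappa> powr (q - 1)) * (ennreal (w x) * T x) \<partial>L) = ennreal (\<kappa> powr q) * mass_a a"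
  proof -
    have "(\<integral>\<^sup>+x. ennreal (w x) * T x \<partial>L) = (\<integral>\<^sup>+x. (\<Sum>n. aq n * ennreal (H x (Suc n) * w x)) \<partial>L)"
    proof (rule nn_integral_cong)
      fix x assume "x \<in> space L"
      then have x: "x > 0" by simp
      show "ennreal (w x) * T x = (\<Sum>n. aq n * ennreal (H x (Suc n) * w x))"
        unfolding T_def ennreal_suminf_cmult[symmetric]
        using H_pos[OF x] w_pos[OF x] by (intro suminf_cong) (simp add: ennreal_mult less_imp_le mult_ac)
    qed
    also have "\<dots> = (\<Sum>n. \<integral>\<^sup>+x. aq n * ennreal (H x (Suc n) * w x) \<partial>L)"
      by (rule nn_integral_suminf) measurable
    also have "\<dots> = (\<Sum>n. aq n * ennreal (W (Suc n) powr - \<sigma> * \<kappa>))"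
    proof (rule suminf_cong)
      fix n
      have "(\<integral>\<^sup>+x. aq n * ennreal (H x (Suc n) * w x) \<partial>L) = aq n * (\<integral>\<^sup>+x. ennreal (H x (Suc n) * w x) \<partial>L)"
        by (rule nn_integral_cmult) measurable
      then show "(\<integral>\<^sup>+x. aq n * ennreal (H x (Suc n) * w x) \<partial>L) = aq n * ennreal (W (Suc n) powr - \<sigma> * \<kappa>)"
        using weight_n[OF \<sigma>(1), of n] \<kappa>_pos by (simp add: w_def k_eq ennreal_mult)
    qed
    also have "\<dots> = (\<Sum>n. ennreal \<kappa> * (ennreal (Psi_tilde q \<sigma> \<nu> \<nu>t (Suc n)) * ennreal (a (Suc n)) epowr q))"
    proof (rule suminf_cong)
      fix n
      have "b n powr (1 - q) * W (Suc n) powr - \<sigma>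
          = \<nu> (Suc n) powr (1 - q) * (W (Suc n) powr ((\<sigma> - 1) * (1 - q)) * W (Suc n) powr - \<sigma>)"
        using \<nu>_pos[of "Suc n"] W_pos[of n] by (simp add: b_def powr_mult powr_powr)
      also have "W (Suc n) powr ((\<sigma> - 1) * (1 - q)) * W (Suc n) powr - \<sigma> = W (Suc n) powr (q * (1 - \<sigma>) - 1)"
        by (simp add: algebra_simps flip: powr_add)
      also have "\<nu> (Suc n) powr (1 - q) = 1 / \<nu> (Suc n) powr (q - 1)"
        using powr_minus_divide[of "\<nu> (Suc n)" "q - 1"] by simp
      finally have *: "b n powr (1 - q) * W (Suc n) powr - \<sigma> = Psi_tilde q \<sigma> \<nu> \<nu>t (Suc n)"
        by (simp add: Psi_tilde_def)
      have "ennreal (b n powr (1 - q)) * ennreal (W (Suc n) powr - \<sigma> * \<kappa>)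
          = ennreal \<kappa> * ennreal (Psi_tilde q \<sigma> \<nu> \<nu>t (Suc n))"
        unfolding *[symmetric] using \<kappa>_pos by (simp add: mult_ac flip: ennreal_mult')
      then show "aq n * ennreal (W (Suc n) powr - \<sigma> * \<kappa>)
          = ennreal \<kappa> * (ennreal (Psi_tilde q \<sigma> \<nu> \<nu>t (Suc n)) * ennreal (a (Suc n)) epowr q)"
        unfolding aq_def by (metis mult.assoc mult.commute)
    qed
    also have "\<dots> = ennreal \<kappa> * mass_a a" by (simp add: mass_a_def)
    finally have "(\<integral>\<^sup>+x. ennreal (w x) * T x \<partial>L) = ennreal \<kappa> * mass_a a" .
    moreover have "(\<integral>\<^sup>+x. ennreal (\<kappa> powr (q - 1)) * (ennreal (w x) * T x) \<partial>L)
        = ennreal (\<kappa> powr (q - 1)) * (\<integral>\<^sup>+x. ennreal (w x) * T x \<partial>L)"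
      by (rule nn_integral_cmult) measurable
    moreover have "\<kappa> powr (q - 1) * \<kappa> = \<kappa> powr q" using \<kappa>_pos by (simp add: powr_diff)
    then have "ennreal (\<kappa> powr (q - 1)) * ennreal \<kappa> = ennreal (\<kappa> powr q)"
      by (simp flip: ennreal_mult')
    ultimately show ?thesis by (simp add: mult.assoc[symmetric])
  qed
  have lower_fin: "(\<integral>\<^sup>+x. ennreal (\<kappa> powr (q - 1)) * (ennreal (w x) * T x) \<partial>L) < \<infinity>"
    using mass by (simp add: lower ennreal_mult_less_top)
  have "AE x in L. ennreal (\<kappa> powr (q - 1)) * (ennreal (w x) * T x) \<noteq> \<infinity>"
    using lower_fin by (intro nn_integral_PInf_AE) auto
  then have AE_less: "AE x in L. x \<in> {0<..} \<longrightarrow>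
      ennreal (\<kappa> powr (q - 1)) * (ennreal (w x) * T x) < ennreal (m x) * G x epowr q"
  proof eventually_elim
    case (elim x)
    show ?case
    proof
      assume "x \<in> {0<..}"
      then have x: "x > 0" by simp
      have "T x \<noteq> \<infinity>" using elim w_pos[OF x] \<kappa>_pos by (auto simp: ennreal_mult_eq_top_iff)
      then show "ennreal (\<kappa> powr (q - 1)) * (ennreal (w x) * T x) < ennreal (m x) * G x epowr q"
        using less[OF x] T_pos[OF x] by (simp add: less_top)
    qed
  qed
  have "ennreal (\<kappa> powr q) * mass_a a < (\<integral>\<^sup>+x. ennreal (m x) * G x epowr q \<partial>L)"
    unfolding lower[symmetric]
  proof (rule nn_integral_strict_mono[where S = "{0<..}"])
    have "AE x in L. x \<in> {0<..}" by (rule AE_I2) simp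
    with AE_less show "AE x in L. ennreal (\<kappa> powr (q - 1)) * (ennreal (w x) * T x) \<le> ennreal (m x) * G x epowr q"
      by eventually_elim auto
  qed (use AE_less lower_fin emeasure_L in \<open>auto simp: sets_restrict_space\<close>)
  then have "(ennreal (\<kappa> powr q) * mass_a a) epowr (1 / q) < (\<integral>\<^sup>+x. ennreal (m x) * G x epowr q \<partial>L) epowr (1 / q)"
    using q(1) by (intro epowr_strict_mono) auto
  moreover have "(ennreal (\<kappa> powr q) * mass_a a) epowr (1 / q) = k \<sigma> * norm_a q \<sigma> \<nu> \<nu>t a"
    using \<kappa>_pos q(1) by (simp add: epowr_cmult powr_powr k_eq norm_a_mass)
  ultimately show "k \<sigma> * norm_a q \<sigma> \<nu> \<nu>t a
    < (\<integral>\<^sup>+x. ennreal (\<mu> x / U x powr (1 - q * \<delta> * \<sigma>))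
        * (\<Sum>n. ennreal (H x (Suc n) * a (Suc n))) epowr q \<partial>L) epowr (1 / q)"
    by (simp add: G_def m_def)
qed

lemma p_minus_pq: "p - p * q = - q"
  using q(3) by simp

text \<open>
  Reverse Hoelder in \<open>n\<close> for the inner integrals \<open>F\<^sub>n\<close> against \<open>a\<^sub>n\<close>: the weight \<open>v\<^sub>n\<close> of the series
  satisfies \<open>v\<^sub>n\<^sup>-\<^sup>q\<^sup>/\<^sup>p = v\<^sub>n\<^sup>1\<^sup>-\<^sup>q\<close>, which is the weight of the norm of \<open>a\<close>.
\<close>

lemma double_of_series:
  assumes "ineq_series \<alpha> \<rho> \<gamma> \<sigma> \<delta> p \<mu> \<nu> \<nu>t C"
  shows "ineq_double \<alpha> \<rho> \<gamma> \<sigma> \<delta> p q \<mu> \<nu> \<nu>t C"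
  unfolding ineq_double_def nn_integral_L
proof (intro allI impI)
  fix f a assume f: "admissible_f p \<delta> \<sigma> \<mu> f" and a: "admissible_a q \<sigma> \<nu> \<nu>t a"
  have [measurable]: "f \<in> borel_measurable L" using f by (simp add: admissible_f_def)
  have a_nonneg: "a (Suc n) \<ge> 0" for n using a by (auto simp: admissible_a_def)
  define F where "F = (\<lambda>n. \<integral>\<^sup>+x. ennreal (H x (Suc n) * f x) \<partial>L)"
  define v where "v = (\<lambda>n. \<nu> (Suc n) / W (Suc n) powr (1 - p * \<sigma>))"
  have v_pos: "v n > 0" for n using \<nu>_pos[of "Suc n"] W_pos[of n] by (simp add: v_def)
  have "(\<integral>\<^sup>+n. (ennreal (v n powr (1 / p)) * F n) epowr p \<partial>count_space UNIV) epowr (1 / p)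
      * (\<integral>\<^sup>+n. (ennreal (v n powr (- 1 / p)) * ennreal (a (Suc n))) epowr q \<partial>count_space UNIV) epowr (1 / q)
      \<le> (\<integral>\<^sup>+n. ennreal (v n powr (1 / p)) * F n * (ennreal (v n powr (- 1 / p)) * ennreal (a (Suc n))) \<partial>count_space UNIV)"
    by (rule reverse_hoelder[OF _ _ p pq]) auto
  also have "(\<integral>\<^sup>+n. (ennreal (v n powr (1 / p)) * F n) epowr p \<partial>count_space UNIV) = (\<Sum>n. ennreal (v n) * F n epowr p)"
    unfolding nn_integral_count_space_nat using v_pos p
    by (intro suminf_cong epowr_cmult_root) auto
  also have "(\<integral>\<^sup>+n. (ennreal (v n powr (- 1 / p)) * ennreal (a (Suc n))) epowr q \<partial>count_space UNIV) = mass_a a"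
    unfolding nn_integral_count_space_nat mass_a_def
  proof (rule suminf_cong)
    fix n
    have "(v n powr (- 1 / p)) powr q = v n powr (1 - q)"
    proof -
      have "- 1 / p * q = 1 - q" using q(5) by simp
      then show ?thesis by (simp only: powr_powr)
    qed
    also have "\<dots> = (\<nu> (Suc n) * W (Suc n) powr (p * \<sigma> - 1)) powr (1 - q)"
      unfolding v_def using W_pos[of n] powr_minus_divide[of "W (Suc n)" "1 - p * \<sigma>"] by simp
    also have "\<dots> = \<nu> (Suc n) powr (1 - q) * W (Suc n) powr ((p * \<sigma> - 1) * (1 - q))"
      using \<nu>_pos[of "Suc n"] W_pos[of n] by (simp add: powr_mult powr_powr)
    also have "(p * \<sigma> - 1) * (1 - q) = (p - p * q) * \<sigma> - 1 + q" by (simp add: algebra_simps)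
    also have "\<dots> = q * (1 - \<sigma>) - 1" unfolding p_minus_pq by (simp add: algebra_simps)
    also have "\<nu> (Suc n) powr (1 - q) = 1 / \<nu> (Suc n) powr (q - 1)"
      using powr_minus_divide[of "\<nu> (Suc n)" "q - 1"] by simp
    finally have "(v n powr (- 1 / p)) powr q = Psi_tilde q \<sigma> \<nu> \<nu>t (Suc n)" by (simp add: Psi_tilde_def)
    then show "(ennreal (v n powr (- 1 / p)) * ennreal (a (Suc n))) epowr q
        = ennreal (Psi_tilde q \<sigma> \<nu> \<nu>t (Suc n)) * ennreal (a (Suc n)) epowr q"
      using v_pos[of n] by (subst epowr_cmult) auto
  qed
  also have "(\<integral>\<^sup>+n. ennreal (v n powr (1 / p)) * F n * (ennreal (v n powr (- 1 / p)) * ennreal (a (Suc n))) \<partial>count_space UNIV)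
      = (\<Sum>n. \<integral>\<^sup>+x. ennreal (H x (Suc n) * a (Suc n) * f x) \<partial>L)"
    unfolding nn_integral_count_space_nat
  proof (rule suminf_cong)
    fix n
    have "v n powr (1 / p) * v n powr (- 1 / p) = 1" using v_pos[of n] by (simp flip: powr_add)
    then have "ennreal (v n powr (1 / p)) * ennreal (v n powr (- 1 / p)) = 1" by (simp flip: ennreal_mult')
    then have "ennreal (v n powr (1 / p)) * F n * (ennreal (v n powr (- 1 / p)) * ennreal (a (Suc n)))
        = ennreal (a (Suc n)) * F n"
      by (metis mult.assoc mult.commute mult_1)
    also have "\<dots> = (\<integral>\<^sup>+x. ennreal (a (Suc n)) * ennreal (H x (Suc n) * f x) \<partial>L)"
      unfolding F_def by (rule nn_integral_cmult[symmetric]) measurable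
    also have "\<dots> = (\<integral>\<^sup>+x. ennreal (H x (Suc n) * a (Suc n) * f x) \<partial>L)"
      using a_nonneg[of n] by (simp add: mult_ac flip: ennreal_mult')
    finally show "ennreal (v n powr (1 / p)) * F n * (ennreal (v n powr (- 1 / p)) * ennreal (a (Suc n)))
        = (\<integral>\<^sup>+x. ennreal (H x (Suc n) * a (Suc n) * f x) \<partial>L)" .
  qed
  finally have le: "(\<Sum>n. ennreal (v n) * F n epowr p) epowr (1 / p) * norm_a q \<sigma> \<nu> \<nu>t a
      \<le> (\<Sum>n. \<integral>\<^sup>+x. ennreal (H x (Suc n) * a (Suc n) * f x) \<partial>L)"
    by (simp add: norm_a_mass)
  have "C * norm_f p \<delta> \<sigma> \<mu> f < (\<Sum>n. ennreal (v n) * F n epowr p) epowr (1 / p)"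
    using assms f by (simp add: ineq_series_def nn_integral_L F_def v_def)
  then have "C * norm_f p \<delta> \<sigma> \<mu> f * norm_a q \<sigma> \<nu> \<nu>t a
      < (\<Sum>n. ennreal (v n) * F n epowr p) epowr (1 / p) * norm_a q \<sigma> \<nu> \<nu>t a"
    using a by (intro ennreal_mult_strict_right_mono) (auto simp: admissible_a_def)
  also note le
  finally show "C * norm_f p \<delta> \<sigma> \<mu> f * norm_a q \<sigma> \<nu> \<nu>t a
      < (\<Sum>n. \<integral>\<^sup>+x. ennreal (H x (Suc n) * a (Suc n) * f x) \<partial>L)" .
qed

text \<open>
  The same argument in \<open>x\<close>: the power \<open>1 - q\<close> of \<open>Phi\<close> is the weight of the integral inequality.
\<close>

lemma double_of_integral:
  assumes "ineq_integral \<alpha> \<rho> \<gamma> \<sigma> \<delta> q \<mu> \<nu> \<nu>t C"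
  shows "ineq_double \<alpha> \<rho> \<gamma> \<sigma> \<delta> p q \<mu> \<nu> \<nu>t C"
  unfolding ineq_double_def nn_integral_L
proof (intro allI impI)
  fix f a assume f: "admissible_f p \<delta> \<sigma> \<mu> f" and a: "admissible_a q \<sigma> \<nu> \<nu>t a"
  have [measurable]: "f \<in> borel_measurable L" and f_nonneg: "\<And>x. x > 0 \<Longrightarrow> f x \<ge> 0"
    using f by (auto simp: admissible_f_def)
  define G where "G = (\<lambda>x. \<Sum>n. ennreal (H x (Suc n) * a (Suc n)))"
  have [measurable]: "G \<in> borel_measurable L" unfolding G_def by measurable
  define J where "J = (\<integral>\<^sup>+x. ennreal (\<mu> x / U x powr (1 - q * \<delta> * \<sigma>)) * G x epowr q \<partial>L)"
  define v where "v = Phi p \<delta> \<sigma> \<mu>"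
  have v_pos: "v x > 0" if "x > 0" for x using Phi_pos[OF that] by (simp add: v_def)
  have [measurable]: "v \<in> borel_measurable L" unfolding v_def by measurable
  have "(\<integral>\<^sup>+x. (ennreal (v x powr (1 / p)) * ennreal (f x)) epowr p \<partial>L) epowr (1 / p)
      * (\<integral>\<^sup>+x. (ennreal (v x powr (- 1 / p)) * G x) epowr q \<partial>L) epowr (1 / q)
      \<le> (\<integral>\<^sup>+x. ennreal (v x powr (1 / p)) * ennreal (f x) * (ennreal (v x powr (- 1 / p)) * G x) \<partial>L)"
    by (rule reverse_hoelder[OF _ _ p pq]) measurable
  also have "(\<integral>\<^sup>+x. (ennreal (v x powr (1 / p)) * ennreal (f x)) epowr p \<partial>L) = mass_f f"
    unfolding mass_f_def v_def[symmetric] using v_pos p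
    by (intro nn_integral_cong epowr_cmult_root) auto
  also have "(\<integral>\<^sup>+x. (ennreal (v x powr (- 1 / p)) * G x) epowr q \<partial>L) = J"
    unfolding J_def
  proof (rule nn_integral_cong)
    fix x assume "x \<in> space L"
    then have x: "x > 0" by simp
    have "(v x powr (- 1 / p)) powr q = v x powr (1 - q)"
    proof -
      have "- 1 / p * q = 1 - q" using q(5) by simp
      then show ?thesis by (simp only: powr_powr)
    qed
    also have "\<dots> = (U x powr (p * (1 - \<delta> * \<sigma>) - 1) * \<mu> x powr (1 - p)) powr (1 - q)"
      unfolding v_def Phi_def using powr_minus_divide[of "\<mu> x" "p - 1"] by simp
    also have "\<dots> = U x powr ((p * (1 - \<delta> * \<sigma>) - 1) * (1 - q)) * \<mu> x powr ((1 - p) * (1 - q))"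
      by (simp add: powr_mult powr_powr)
    also have "(1 - p) * (1 - q) = 1" using q(3) by (simp add: algebra_simps)
    also have "(p * (1 - \<delta> * \<sigma>) - 1) * (1 - q) = (p - p * q) * (1 - \<delta> * \<sigma>) - 1 + q"
      by (simp add: algebra_simps)
    also have "\<dots> = q * \<delta> * \<sigma> - 1" unfolding p_minus_pq by (simp add: algebra_simps)
    also have "U x powr (q * \<delta> * \<sigma> - 1) = 1 / U x powr (1 - q * \<delta> * \<sigma>)"
      using powr_minus_divide[of "U x" "1 - q * \<delta> * \<sigma>"] by simp
    finally have "(v x powr (- 1 / p)) powr q = \<mu> x / U x powr (1 - q * \<delta> * \<sigma>)"
      using \<mu>_pos[OF x] by simp
    then show "(ennreal (v x powr (- 1 / p)) * G x) epowr q
        = ennreal (\<mu> x / U x powr (1 - q * \<delta> * \<sigma>)) * G x epowr q"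
      using v_pos[OF x] by (subst epowr_cmult) auto
  qed
  also have "(\<integral>\<^sup>+x. ennreal (v x powr (1 / p)) * ennreal (f x) * (ennreal (v x powr (- 1 / p)) * G x) \<partial>L)
      = (\<integral>\<^sup>+x. (\<Sum>n. ennreal (H x (Suc n) * a (Suc n) * f x)) \<partial>L)"
  proof (rule nn_integral_cong)
    fix x assume "x \<in> space L"
    then have x: "x > 0" by simp
    have "v x powr (1 / p) * v x powr (- 1 / p) = 1" using v_pos[OF x] by (simp flip: powr_add)
    then have "ennreal (v x powr (1 / p)) * ennreal (v x powr (- 1 / p)) = 1" by (simp flip: ennreal_mult')
    then have "ennreal (v x powr (1 / p)) * ennreal (f x) * (ennreal (v x powr (- 1 / p)) * G x)
        = ennreal (f x) * G x"
      by (metis mult.assoc mult.commute mult_1)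
    also have "\<dots> = (\<Sum>n. ennreal (H x (Suc n) * a (Suc n) * f x))"
      unfolding G_def ennreal_suminf_cmult[symmetric]
      using f_nonneg[OF x] by (intro suminf_cong) (simp add: mult_ac flip: ennreal_mult')
    finally show "ennreal (v x powr (1 / p)) * ennreal (f x) * (ennreal (v x powr (- 1 / p)) * G x)
        = (\<Sum>n. ennreal (H x (Suc n) * a (Suc n) * f x))" .
  qed
  also have "\<dots> = (\<Sum>n. \<integral>\<^sup>+x. ennreal (H x (Suc n) * a (Suc n) * f x) \<partial>L)"
    by (rule nn_integral_suminf) measurable
  finally have le: "norm_f p \<delta> \<sigma> \<mu> f * J epowr (1 / q)
      \<le> (\<Sum>n. \<integral>\<^sup>+x. ennreal (H x (Suc n) * a (Suc n) * f x) \<partial>L)"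
    by (simp add: norm_f_mass)
  have "C * norm_a q \<sigma> \<nu> \<nu>t a < J epowr (1 / q)"
    using assms a by (simp add: ineq_integral_def nn_integral_L G_def J_def)
  then have "norm_f p \<delta> \<sigma> \<mu> f * (C * norm_a q \<sigma> \<nu> \<nu>t a) < norm_f p \<delta> \<sigma> \<mu> f * J epowr (1 / q)"
    using f by (intro ennreal_mult_strict_left_mono) (auto simp: admissible_f_def)
  also note le
  finally show "C * norm_f p \<delta> \<sigma> \<mu> f * norm_a q \<sigma> \<nu> \<nu>t a
      < (\<Sum>n. \<integral>\<^sup>+x. ennreal (H x (Suc n) * a (Suc n) * f x) \<partial>L)"
    by (simp add: mult_ac)
qed

end

section \<open>The test functions\<close>

text \<open>
  The graph of \<open>x\<^sup>-\<^sup>e\<close> lies above its tangents.  At the two ends of a cell this compares the terms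
  \<open>\<nu>\<^sub>n V\<^sub>n\<^sup>-\<^sup>1\<^sup>-\<^sup>e\<close> with the telescoping differences of \<open>V\<^sub>n\<^sup>-\<^sup>e/e\<close>, from both sides.
\<close>

lemma powr_neg_above_tangent:
  fixes x c e :: real
  assumes "x > 0" "c > 0" "e > 0"
  shows "c powr - e - e * c powr (- 1 - e) * (x - c) \<le> x powr - e"
proof -
  have "1 - e * (x / c - 1) \<le> 1 + (- e * ln (x / c))"
    using ln_le_minus_one[of "x / c"] assms by simp
  also have "\<dots> \<le> exp (- e * ln (x / c))" by (rule exp_ge_add_one_self)
  also have "\<dots> = (x / c) powr - e" using assms by (simp add: powr_def)
  finally have "c powr - e * (1 - e * (x / c - 1)) \<le> c powr - e * (x / c) powr - e"
    by (rule mult_left_mono) simp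
  also have "\<dots> = x powr - e" using assms by (simp add: powr_divide)
  also have "c powr - e * (1 - e * (x / c - 1)) = c powr - e - e * (c powr - e / c) * (x - c)"
    using assms by (simp add: field_simps)
  also have "c powr - e / c = c powr (- e - 1)"
    using assms by (simp add: powr_diff)
  also have "- e - 1 = - 1 - e" by simp
  finally show ?thesis .
qed

locale half_discrete_divergent = half_discrete +
  fixes n0 :: nat
  assumes n0: "n0 \<ge> 1" and decr: "\<And>n. n \<ge> n0 \<Longrightarrow> \<nu> n \<ge> \<nu> (Suc n)"
    and V_infty: "V_infty \<nu> = \<infinity>"
begin

lemma V_unbounded: "\<exists>n. V n > B"
proof (rule ccontr)
  assume "\<not> ?thesis"
  then have B: "V n \<le> B" for n by (auto simp: not_less)
  have "(\<Sum>n. ennreal (\<nu> (Suc n))) \<le> ennreal B"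
  proof (rule suminf_le_const)
    fix n
    have "(\<Sum>i<n. ennreal (\<nu> (Suc i))) = ennreal (V n)"
      unfolding partial_sum_def using \<nu>_pos
      by (subst sum_ennreal) (auto simp: less_imp_le sum.atLeast1_atMost_eq)
    then show "(\<Sum>i<n. ennreal (\<nu> (Suc i))) \<le> ennreal B" using B by (simp add: ennreal_leI)
  qed simp
  then show False using V_infty by (simp add: V_infty_def top_unique)
qed

lemma V_tendsto: "filterlim V at_top sequentially"
  unfolding filterlim_at_top_gt[where c = 0]
proof (intro allI impI)
  fix B :: real
  obtain N where "V N > B" using V_unbounded by blast
  then show "eventually (\<lambda>n. B \<le> V n) sequentially"
    using V_mono by (intro eventually_sequentiallyI[of N]) (meson less_imp_le order_trans)
qed

lemma W_ge_half: "V (Suc n) / 2 \<le> W (Suc n)"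
  using W_ge_midpoint[of n] V_nonneg[of n] by (simp add: partial_sum_Suc)

definition test_sum :: "real \<Rightarrow> ennreal" where
  "test_sum e = (\<Sum>n. ennreal (\<nu> (Suc n) * W (Suc n) powr (- 1 - e)))"

text \<open>
  As \<open>W\<^sub>n \<ge> V\<^sub>n/2\<close>, it suffices to bound \<open>\<Sum> \<nu>\<^sub>n V\<^sub>n\<^sup>-\<^sup>1\<^sup>-\<^sup>e\<close>; apart from the first term, it is dominated by a
  telescoping sum.
\<close>

lemma test_sum_finite:
  assumes e: "e > 0" shows "test_sum e < \<infinity>"
proof -
  define c where "c = (1 / 2) powr (- 1 - e)"
  define B where "B = V (Suc 0) powr - e * (1 + 1 / e)"
  have term_le: "\<nu> (Suc n) * W (Suc n) powr (- 1 - e) \<le> c * (\<nu> (Suc n) * V (Suc n) powr (- 1 - e))" for n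
  proof -
    have "W (Suc n) powr (- 1 - e) \<le> (1 / 2 * V (Suc n)) powr (- 1 - e)"
      using W_ge_half[of n] V_pos[of n] e by (intro powr_mono2') auto
    also have "\<dots> = c * V (Suc n) powr (- 1 - e)" using V_pos[of n] by (simp only: powr_mult c_def)
    finally have "\<nu> (Suc n) * W (Suc n) powr (- 1 - e) \<le> \<nu> (Suc n) * (c * V (Suc n) powr (- 1 - e))"
      using \<nu>_pos[of "Suc n"] by (intro mult_left_mono) auto
    then show ?thesis by (simp add: mult_ac)
  qed
  have partial: "(\<Sum>n<Suc N. \<nu> (Suc n) * V (Suc n) powr (- 1 - e)) \<le> B - V (Suc N) powr - e / e" for N
  proof (induction N)
    case 0
    have "\<nu> (Suc 0) = V (Suc 0)" by (simp add: partial_sum_def)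
    then have "\<nu> (Suc 0) * V (Suc 0) powr (- 1 - e) = V (Suc 0) powr - e"
      using V_pos[of 0] by (simp add: powr_diff powr_minus field_simps)
    then show ?case by (simp add: B_def algebra_simps)
  next
    case (Suc N)
    have "V (Suc (Suc N)) powr - e + e * V (Suc (Suc N)) powr (- 1 - e) * \<nu> (Suc (Suc N)) \<le> V (Suc N) powr - e"
      using powr_neg_above_tangent[of "V (Suc N)" "V (Suc (Suc N))" e] V_pos[of N] V_pos[of "Suc N"] e
      by (simp add: partial_sum_Suc[of "Suc N"])
    then have "\<nu> (Suc (Suc N)) * V (Suc (Suc N)) powr (- 1 - e)
        \<le> V (Suc N) powr - e / e - V (Suc (Suc N)) powr - e / e"
      using e by (simp add: field_simps)
    then show ?case using Suc by simp
  qed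
  have "test_sum e \<le> ennreal (c * B)"
    unfolding test_sum_def
  proof (rule suminf_le_const)
    fix N
    have "(\<Sum>n<N. ennreal (\<nu> (Suc n) * W (Suc n) powr (- 1 - e)))
        = ennreal (\<Sum>n<N. \<nu> (Suc n) * W (Suc n) powr (- 1 - e))"
      using \<nu>_pos by (intro sum_ennreal) (simp add: less_imp_le)
    also have "(\<Sum>n<N. \<nu> (Suc n) * W (Suc n) powr (- 1 - e))
        \<le> (\<Sum>n<Suc N. \<nu> (Suc n) * W (Suc n) powr (- 1 - e))"
      using \<nu>_pos[of "Suc N"] by simp
    also have "\<dots> \<le> c * (\<Sum>n<Suc N. \<nu> (Suc n) * V (Suc n) powr (- 1 - e))"
      unfolding sum_distrib_left by (intro sum_mono term_le)
    also have "\<dots> \<le> c * (B - V (Suc N) powr - e / e)"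
      by (intro mult_left_mono partial) (simp add: c_def)
    also have "\<dots> \<le> c * B" using e by (simp add: c_def)
    finally show "(\<Sum>n<N. ennreal (\<nu> (Suc n) * W (Suc n) powr (- 1 - e))) \<le> ennreal (c * B)"
      by (simp add: ennreal_leI)
  qed simp
  then show ?thesis by (rule le_less_trans) simp
qed

text \<open>
  From the index \<open>n0\<close> on, \<open>\<nu>\<^sub>n \<ge> \<nu>\<^sub>n\<^sub>+\<^sub>1\<close>, so each term dominates \<open>\<nu>\<^sub>n\<^sub>+\<^sub>1 V\<^sub>n\<^sup>-\<^sup>1\<^sup>-\<^sup>e\<close>, the product of a cell length with
  the value at the left end.  The sum therefore exceeds the telescoping sum of
  \<open>V\<^sub>n\<^sup>-\<^sup>e/e\<close>, whose remote end vanishes in the limit since \<open>V\<^sub>n\<close> tends to infinity.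
\<close>

lemma test_sum_ge:
  assumes e: "e > 0" shows "ennreal (V n0 powr - e / e) \<le> test_sum e"
proof -
  obtain m where m: "n0 = Suc m" using n0 by (cases n0) auto
  define s where "s = enn2real (test_sum e)"
  have s: "test_sum e = ennreal s" using test_sum_finite[OF e] by (simp add: s_def)
  have term_ge: "V (Suc n) powr - e / e - V (Suc (Suc n)) powr - e / e \<le> \<nu> (Suc n) * W (Suc n) powr (- 1 - e)"
    if "n \<ge> m" for n
  proof -
    have "V (Suc n) powr - e - e * V (Suc n) powr (- 1 - e) * \<nu> (Suc (Suc n)) \<le> V (Suc (Suc n)) powr - e"
      using powr_neg_above_tangent[of "V (Suc (Suc n))" "V (Suc n)" e] V_pos[of n] V_pos[of "Suc n"] e
      by (simp add: partial_sum_Suc[of "Suc n"])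
    then have "V (Suc n) powr - e / e - V (Suc (Suc n)) powr - e / e \<le> \<nu> (Suc (Suc n)) * V (Suc n) powr (- 1 - e)"
      using e by (simp add: field_simps)
    also have "\<dots> \<le> \<nu> (Suc n) * W (Suc n) powr (- 1 - e)"
      using decr[of "Suc n"] that m \<nu>_pos[of "Suc n"] W_le[of n] W_pos[of n] e
      by (intro mult_mono powr_mono2') auto
    finally show ?thesis .
  qed
  have partial: "V (Suc m) powr - e / e - V (Suc (m + N)) powr - e / e
      \<le> (\<Sum>n<m + N. \<nu> (Suc n) * W (Suc n) powr (- 1 - e))" for N
  proof (induction N)
    case 0
    then show ?case using \<nu>_pos by (auto intro!: sum_nonneg simp: less_imp_le)
  next
    case (Suc N)
    then show ?case using term_ge[of "m + N"] by simp
  qed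
  have "V (Suc m) powr - e / e - V (Suc (m + N)) powr - e / e \<le> s" for N
  proof -
    have "ennreal (V (Suc m) powr - e / e - V (Suc (m + N)) powr - e / e)
        \<le> ennreal (\<Sum>n<m + N. \<nu> (Suc n) * W (Suc n) powr (- 1 - e))" by (intro ennreal_leI partial)
    also have "\<dots> = (\<Sum>n<m + N. ennreal (\<nu> (Suc n) * W (Suc n) powr (- 1 - e)))"
      using \<nu>_pos by (intro sum_ennreal[symmetric]) (simp add: less_imp_le)
    also have "\<dots> \<le> test_sum e" unfolding test_sum_def by (rule sum_le_suminf) auto
    finally show ?thesis unfolding s by (subst (asm) ennreal_le_iff) (auto simp: s_def)
  qed
  moreover have "(\<lambda>N. V (Suc m) powr - e / e - V (Suc (m + N)) powr - e / e) \<longlonglongrightarrow> V (Suc m) powr - e / e - 0 / e"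
  proof (intro tendsto_intros tendsto_neg_powr)
    have "filterlim (\<lambda>N. Suc (m + N)) at_top sequentially"
      by (intro filterlim_subseq) (simp add: strict_mono_def)
    then show "filterlim (\<lambda>N. V (Suc (m + N))) at_top sequentially"
      by (rule filterlim_compose[OF V_tendsto])
  qed (use e in auto)
  ultimately have "V (Suc m) powr - e / e - 0 / e \<le> s"
    by (intro LIMSEQ_le_const2) auto
  then show ?thesis using m by (simp add: s ennreal_leI)
qed

text \<open>
  With \<open>u = U(x)\<^sup>\<delta>\<close>, the extremal power of \<open>u\<close> is perturbed to \<open>u\<^sup>e\<^sup>/\<^sup>p\<close>, which makes the norm integral
  converge at \<open>u = 0\<close> with value about \<open>1/e\<close>.  Since \<open>p < 0\<close>, a test function must not vanish for large
  \<open>u\<close> (its \<open>p\<close>-th power would be infinite there) but has to grow; the second summand \<open>u\<close> provides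
  this at a bounded cost in the double series.
\<close>

definition test_f :: "real \<Rightarrow> real \<Rightarrow> real" where
  "test_f e x = \<mu> x * U x powr (\<delta> * \<sigma> - 1) * (U x powr (\<delta> * (e / p)) + U x powr \<delta>)"

definition test_a :: "real \<Rightarrow> nat \<Rightarrow> real" where
  "test_a e n = \<nu> n * W n powr (\<sigma> - 1 - e / q)"

lemma measurable_test_f [measurable]: "test_f e \<in> borel_measurable L"
  unfolding test_f_def[abs_def] by measurable

lemma mass_test_a: "mass_a (test_a e) = test_sum e"
  unfolding mass_a_def test_sum_def
proof (rule suminf_cong)
  fix n
  define v w where "v = \<nu> (Suc n)" and "w = W (Suc n)"
  have vw: "v > 0" "w > 0" using \<nu>_pos[of "Suc n"] W_pos[of n] by (auto simp: v_def w_def)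
  have "w powr (q * (1 - \<sigma>) - 1) / v powr (q - 1) * (v * w powr (\<sigma> - 1 - e / q)) powr q
    = (v powr (1 - q) * v powr q) * (w powr (q * (1 - \<sigma>) - 1) * w powr ((\<sigma> - 1 - e / q) * q))"
    using vw powr_minus_divide[of v "q - 1"] by (simp add: powr_mult powr_powr)
  also have "v powr (1 - q) * v powr q = v" using vw by (simp flip: powr_add)
  also have "w powr (q * (1 - \<sigma>) - 1) * w powr ((\<sigma> - 1 - e / q) * q) = w powr (- 1 - e)"
    using q(1) by (simp add: algebra_simps flip: powr_add)
  finally show "ennreal (Psi_tilde q \<sigma> \<nu> \<nu>t (Suc n)) * ennreal (test_a e (Suc n)) epowr q
      = ennreal (\<nu> (Suc n) * W (Suc n) powr (- 1 - e))"
    using vw by (simp add: Psi_tilde_def test_a_def epowr_ennreal flip: ennreal_mult' v_def w_def)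
qed

text \<open>
  In the variable \<open>t = U(x)\<^sup>\<delta>\<close> the integrand is \<open>(t\<^sup>e\<^sup>/\<^sup>p + t)\<^sup>p/t\<close>.  Because \<open>p < 0\<close>, keeping one summand only
  gives upper bounds: \<open>t\<^sup>e\<^sup>-\<^sup>1\<close> for \<open>t < 1\<close> and \<open>t\<^sup>p\<^sup>-\<^sup>1\<close> for \<open>t \<ge> 1\<close>.
\<close>

lemma mass_test_f:
  assumes e: "e > 0"
  shows "0 < mass_f (test_f e)" "mass_f (test_f e) \<le> ennreal (1 / e - 1 / p)"
proof -
  define F where "F = (\<lambda>t::real. t powr -1 * (t powr (e / p) + t) powr p)"
  have [measurable]: "F \<in> borel_measurable borel" unfolding F_def by measurable
  have F_pos: "F t > 0" if "t > 0" for t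
    using that by (simp add: F_def add_pos_pos less_imp_neq[symmetric])
  have integral_F: "(\<integral>\<^sup>+t\<in>{0<..}. ennreal (F t) \<partial>lborel) \<le> ennreal (1 / e - 1 / p)"
  proof -
    have "(\<integral>\<^sup>+t\<in>{0<..}. ennreal (F t) \<partial>lborel)
        \<le> (\<integral>\<^sup>+t. ennreal (t powr (e - 1)) * indicator {0..1} t
            + ennreal (t powr (p - 1)) * indicator {1..} t \<partial>lborel)"
    proof (rule nn_integral_mono)
      fix t :: real
      consider "t \<le> 0" | "0 < t" "t < 1" | "t \<ge> 1" by linarith
      then show "ennreal (F t) * indicator {0<..} t
        \<le> ennreal (t powr (e - 1)) * indicator {0..1} t + ennreal (t powr (p - 1)) * indicator {1..} t"
      proof cases
        case 2
        have "(t powr (e / p) + t) powr p \<le> (t powr (e / p)) powr p"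
          using 2 p by (intro powr_mono2') auto
        also have "\<dots> = t powr e" using p by (simp add: powr_powr)
        finally have "F t \<le> t powr -1 * t powr e" unfolding F_def by (intro mult_left_mono) auto
        also have "\<dots> = t powr (e - 1)" using 2 by (simp add: powr_diff)
        finally show ?thesis using 2 by (simp add: ennreal_leI)
      next
        case 3
        have "(t powr (e / p) + t) powr p \<le> t powr p"
          using 3 p by (intro powr_mono2') auto
        then have "F t \<le> t powr -1 * t powr p" unfolding F_def by (intro mult_left_mono) auto
        also have "\<dots> = t powr (p - 1)" using 3 by (simp add: powr_diff)
        finally have "ennreal (F t) \<le> ennreal (t powr (p - 1))" by (rule ennreal_leI)
        then show ?thesis using 3 by (simp add: add_increasing)
      qed simp
    qed
    also have "\<dots> = ennreal (1 / e) + ennreal (- 1 / p)"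
      using e p by (subst nn_integral_add) (auto simp: nn_integral_powr_0_1 nn_integral_powr_1_inf)
    also have "\<dots> = ennreal (1 / e - 1 / p)"
      using e p by (subst ennreal_plus[symmetric]) auto
    finally show ?thesis .
  qed
  have integrand: "ennreal (Phi p \<delta> \<sigma> \<mu> x) * ennreal (test_f e x) epowr p
      = ennreal (1 * U x powr (\<delta> - 1) * \<mu> x * F (1 * U x powr \<delta>))" if x: "x > 0" for x
  proof -
    define u m where "u = U x" and "m = \<mu> x"
    define g where "g = u powr (\<delta> * (e / p)) + u powr \<delta>"
    have um: "u > 0" "m > 0" using U_pos[OF x] \<mu>_pos[OF x] by (auto simp: u_def m_def)
    then have g: "g > 0" by (simp add: g_def add_pos_pos)
    have "u powr (p * (1 - \<delta> * \<sigma>) - 1) / m powr (p - 1) * (m * u powr (\<delta> * \<sigma> - 1) * g) powr p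
      = (m powr (1 - p) * m powr p) * (u powr (p * (1 - \<delta> * \<sigma>) - 1) * u powr ((\<delta> * \<sigma> - 1) * p)) * g powr p"
      using um g powr_minus_divide[of m "p - 1"] by (simp add: powr_mult powr_powr)
    also have "m powr (1 - p) * m powr p = m" using um by (simp flip: powr_add)
    also have "u powr (p * (1 - \<delta> * \<sigma>) - 1) * u powr ((\<delta> * \<sigma> - 1) * p) = u powr (\<delta> - 1) * (u powr \<delta>) powr -1"
      by (simp only: powr_powr powr_add[symmetric]) (simp add: algebra_simps)
    finally have "Phi p \<delta> \<sigma> \<mu> x * test_f e x powr p = u powr (\<delta> - 1) * m * ((u powr \<delta>) powr -1 * g powr p)"
      by (simp only: Phi_def test_f_def u_def[symmetric] m_def[symmetric] g_def[symmetric] mult_ac)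
    then have "Phi p \<delta> \<sigma> \<mu> x * test_f e x powr p = 1 * U x powr (\<delta> - 1) * \<mu> x * F (1 * U x powr \<delta>)"
      by (simp only: F_def g_def powr_powr u_def[symmetric] m_def[symmetric] mult_1)
    moreover have "test_f e x > 0" using um g by (simp add: test_f_def u_def m_def g_def)
    ultimately show ?thesis by (simp add: epowr_ennreal flip: ennreal_mult'')
  qed
  have mass: "mass_f (test_f e) = (\<integral>\<^sup>+x. ennreal (1 * U x powr (\<delta> - 1) * \<mu> x * F (1 * U x powr \<delta>)) \<partial>L)"
    unfolding mass_f_def by (intro nn_integral_cong integrand) simp
  also have "\<dots> = (\<integral>\<^sup>+t\<in>{0<..}. ennreal (F t) \<partial>lborel)"
    using F_pos le_less_trans[OF integral_F] by (intro substitution_U) (auto intro: less_imp_le)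
  finally show "mass_f (test_f e) \<le> ennreal (1 / e - 1 / p)" using integral_F by simp
  have "(\<integral>\<^sup>+x. 0 \<partial>L) < mass_f (test_f e)"
    unfolding mass
  proof (rule nn_integral_strict_mono[of _ _ _ "{0<..}"])
    show "AE x in L. x \<in> {0<..} \<longrightarrow> 0 < ennreal (1 * U x powr (\<delta> - 1) * \<mu> x * F (1 * U x powr \<delta>))"
    proof (rule AE_I2, rule impI)
      fix x :: real assume "x \<in> {0<..}"
      then show "0 < ennreal (1 * U x powr (\<delta> - 1) * \<mu> x * F (1 * U x powr \<delta>))"
        using U_pos[of x] \<mu>_pos[of x] F_pos[of "U x powr \<delta>"] by simp
    qed
  qed (use emeasure_L in \<open>auto simp: sets_restrict_space\<close>)
  then show "0 < mass_f (test_f e)" by simp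
qed

text \<open>
  Each of the two summands of the test function is a pure power, so its integral is a moment of the
  kernel.  The first yields \<open>k(\<sigma> + e/p) S(e)\<close>; the second yields a series whose terms carry the power
  \<open>-2 - e/q\<close> of \<open>W\<^sub>n\<close>, bounded in \<open>e\<close> because \<open>W\<^sub>n \<ge> \<nu>\<^sub>1/2\<close>.
\<close>

lemma double_test:
  assumes e: "e > 0" "\<sigma> + e / p > \<gamma>"
  shows "(\<Sum>n. \<integral>\<^sup>+x. ennreal (H x (Suc n) * test_a e (Suc n) * test_f e x) \<partial>L)
    \<le> k (\<sigma> + e / p) * test_sum e + k (\<sigma> + 1) * ennreal ((\<nu> 1 / 2) powr - (e / q)) * test_sum 1"
proof -
  have "(\<integral>\<^sup>+x. ennreal (H x (Suc n) * test_a e (Suc n) * test_f e x) \<partial>L)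
      \<le> k (\<sigma> + e / p) * ennreal (\<nu> (Suc n) * W (Suc n) powr (- 1 - e))
        + k (\<sigma> + 1) * ennreal ((\<nu> 1 / 2) powr - (e / q)) * ennreal (\<nu> (Suc n) * W (Suc n) powr (- 1 - 1))" for n
  proof -
    define v w where "v = \<nu> (Suc n)" and "w = W (Suc n)"
    have vw: "v > 0" "w > 0" using \<nu>_pos[of "Suc n"] W_pos[of n] by (auto simp: v_def w_def)
    define c where "c = v * w powr (\<sigma> - 1 - e / q)"
    have c: "c > 0" using vw by (simp add: c_def)
    have "(\<integral>\<^sup>+x. ennreal (H x (Suc n) * test_a e (Suc n) * test_f e x) \<partial>L)
      = (\<integral>\<^sup>+x. ennreal c * ennreal (H x (Suc n) * (\<mu> x * U x powr (\<delta> * (\<sigma> + e / p) - 1)))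
          + ennreal c * ennreal (H x (Suc n) * (\<mu> x * U x powr (\<delta> * (\<sigma> + 1) - 1))) \<partial>L)"
    proof (rule nn_integral_cong)
      fix x assume "x \<in> space L"
      then have x: "x > 0" by simp
      have "U x powr (\<delta> * \<sigma> - 1) * (U x powr (\<delta> * (e / p)) + U x powr \<delta>)
          = U x powr (\<delta> * (\<sigma> + e / p) - 1) + U x powr (\<delta> * (\<sigma> + 1) - 1)"
        by (simp only: distrib_left powr_add[symmetric]) (simp add: algebra_simps)
      then have "H x (Suc n) * test_a e (Suc n) * test_f e x
          = c * (H x (Suc n) * (\<mu> x * U x powr (\<delta> * (\<sigma> + e / p) - 1)))
          + c * (H x (Suc n) * (\<mu> x * U x powr (\<delta> * (\<sigma> + 1) - 1)))"
        unfolding test_f_def test_a_def v_def[symmetric] w_def[symmetric] c_def[symmetric] mult.assoc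
        by (simp add: algebra_simps)
      then show "ennreal (H x (Suc n) * test_a e (Suc n) * test_f e x)
        = ennreal c * ennreal (H x (Suc n) * (\<mu> x * U x powr (\<delta> * (\<sigma> + e / p) - 1)))
          + ennreal c * ennreal (H x (Suc n) * (\<mu> x * U x powr (\<delta> * (\<sigma> + 1) - 1)))"
        using c H_pos[OF x, of n] \<mu>_pos[OF x] by (simp add: ennreal_plus ennreal_mult')
    qed
    also have "\<dots> = ennreal c * (\<integral>\<^sup>+x. ennreal (H x (Suc n) * (\<mu> x * U x powr (\<delta> * (\<sigma> + e / p) - 1))) \<partial>L)
          + ennreal c * (\<integral>\<^sup>+x. ennreal (H x (Suc n) * (\<mu> x * U x powr (\<delta> * (\<sigma> + 1) - 1))) \<partial>L)"
      by (subst nn_integral_add) (measurable, simp add: nn_integral_cmult)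
    also have "\<dots> = k (\<sigma> + e / p) * ennreal (c * w powr - (\<sigma> + e / p)) + k (\<sigma> + 1) * ennreal (c * w powr - (\<sigma> + 1))"
      using weight_n[OF e(2), of n] weight_n[of "\<sigma> + 1" n] \<sigma> \<gamma> c
      by (simp add: ennreal_mult' mult_ac flip: w_def)
    also have "c * w powr - (\<sigma> + e / p) = v * w powr (- 1 - e)"
    proof -
      have "e / p + e / q = e" using pq by (metis distrib_left mult.right_neutral times_divide_eq_right)
      then have "\<sigma> - 1 - e / q + - (\<sigma> + e / p) = - 1 - e" by linarith
      then show ?thesis unfolding c_def by (simp only: mult.assoc powr_add[symmetric])
    qed
    also have "k (\<sigma> + e / p) * ennreal (v * w powr (- 1 - e)) + k (\<sigma> + 1) * ennreal (c * w powr - (\<sigma> + 1))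
      \<le> k (\<sigma> + e / p) * ennreal (v * w powr (- 1 - e))
        + k (\<sigma> + 1) * ennreal ((\<nu> 1 / 2) powr - (e / q) * (v * w powr (- 1 - 1)))"
    proof (intro add_left_mono mult_left_mono ennreal_leI)
      have "\<nu> 1 \<le> V (Suc n)" using V_mono[of 1 "Suc n"] by (simp add: partial_sum_def)
      then have "w powr - (e / q) \<le> (\<nu> 1 / 2) powr - (e / q)"
        using W_ge_half[of n] \<nu>_pos[of 1] e(1) q(1) by (intro powr_mono2') (auto simp: w_def)
      then have "v * w powr (- 1 - 1) * w powr - (e / q) \<le> v * w powr (- 1 - 1) * (\<nu> 1 / 2) powr - (e / q)"
        using vw by (intro mult_left_mono) auto
      moreover have "c * w powr - (\<sigma> + 1) = v * w powr (- 1 - 1) * w powr - (e / q)"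
        unfolding c_def by (simp only: mult.assoc powr_add[symmetric]) simp
      ultimately show "c * w powr - (\<sigma> + 1) \<le> (\<nu> 1 / 2) powr - (e / q) * (v * w powr (- 1 - 1))"
        by (simp add: mult_ac)
    qed simp
    also have "ennreal ((\<nu> 1 / 2) powr - (e / q) * (v * w powr (- 1 - 1)))
        = ennreal ((\<nu> 1 / 2) powr - (e / q)) * ennreal (v * w powr (- 1 - 1))"
      by (rule ennreal_mult') simp
    finally show ?thesis by (simp only: v_def w_def mult.assoc)
  qed
  then have "(\<Sum>n. \<integral>\<^sup>+x. ennreal (H x (Suc n) * test_a e (Suc n) * test_f e x) \<partial>L)
    \<le> (\<Sum>n. k (\<sigma> + e / p) * ennreal (\<nu> (Suc n) * W (Suc n) powr (- 1 - e))
        + k (\<sigma> + 1) * ennreal ((\<nu> 1 / 2) powr - (e / q)) * ennreal (\<nu> (Suc n) * W (Suc n) powr (- 1 - 1)))"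
    by (intro suminf_le) auto
  also have "\<dots> = k (\<sigma> + e / p) * test_sum e + k (\<sigma> + 1) * ennreal ((\<nu> 1 / 2) powr - (e / q)) * test_sum 1"
    unfolding test_sum_def by (subst suminf_add[symmetric]) (simp_all only: ennreal_suminf_cmult summableI)
  finally show ?thesis .
qed

text \<open>
  After division by \<open>S(e)\<close> the test functions give an inequality between elementary functions of \<open>e\<close>
  (\<open>bound\<close>), where \<open>S(e)\<close> is eliminated by its lower bound \<open>V0\<^sup>-\<^sup>e/e\<close> and the moment \<open>k(\<sigma> + e/p)\<close> by
  interpolation between \<open>k(\<sigma>)\<close> and \<open>k(s0)\<close>.  Its limit as \<open>e\<close> tends to 0 from the right is \<open>C \<le> k(\<sigma>)\<close>.
\<close>

theorem not_ineq_double: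
  assumes C: "k \<sigma> < ennreal C"
  shows "\<not> ineq_double \<alpha> \<rho> \<gamma> \<sigma> \<delta> p q \<mu> \<nu> \<nu>t (ennreal C)"
proof
  assume double: "ineq_double \<alpha> \<rho> \<gamma> \<sigma> \<delta> p q \<mu> \<nu> \<nu>t (ennreal C)"
  have C_gt: "C > \<kappa>" using C \<kappa>_pos by (simp add: k_eq ennreal_less_iff)
  \<comment> \<open>Any exponent strictly between \<open>\<gamma>\<close> and \<open>\<sigma>\<close> would do.\<close>
  define s0 where "s0 = (\<sigma> + \<gamma>) / 2"
  define \<kappa>0 where "\<kappa>0 = enn2real (k s0)"
  define \<kappa>2 where "\<kappa>2 = enn2real (k (\<sigma> + 1))"
  define T1 where "T1 = enn2real (test_sum 1)"
  have reals: "k s0 = ennreal \<kappa>0" "k (\<sigma> + 1) = ennreal \<kappa>2" "test_sum 1 = ennreal T1"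
    "\<kappa>0 \<ge> 0" "\<kappa>2 \<ge> 0" "T1 \<ge> 0"
    using k_finite[of s0] k_finite[of "\<sigma> + 1"] test_sum_finite[of 1] \<sigma>
    by (auto simp: \<kappa>0_def \<kappa>2_def T1_def s0_def)
  \<comment> \<open>The interpolation parameter for which \<open>(1 - \<theta>) \<sigma> + \<theta> s0 = \<sigma> + e/p\<close>; it stays below 1 for \<open>e < e0\<close>.\<close>
  define \<theta> where "\<theta> = (\<lambda>e. e / - p / (\<sigma> - s0))"
  define e0 where "e0 = - p * (\<sigma> - s0)"
  have d: "\<sigma> - s0 > 0" using \<sigma> by (simp add: s0_def)
  have e0: "e0 > 0" using p d by (simp add: e0_def mult_neg_pos)
  define V0 where "V0 = V n0"
  have V0: "V0 > 0" using V_pos n0 by (cases n0) (auto simp: V0_def)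
  define w0 where "w0 = \<nu> 1 / 2"
  have w0: "w0 > 0" using \<nu>_pos[of 1] by (simp add: w0_def)
  have bound: "C * ((1 - e / p) * V0 powr e) powr (1 / p)
      \<le> (1 - \<theta> e) * \<kappa> + \<theta> e * \<kappa>0 + \<kappa>2 * w0 powr - (e / q) * T1 * (e * V0 powr e)"
    if e: "0 < e" "e < e0" for e
  proof -
    have \<theta>: "0 \<le> \<theta> e" "\<theta> e \<le> 1" "(1 - \<theta> e) * \<sigma> + \<theta> e * s0 = \<sigma> + e / p"
    proof -
      show "0 \<le> \<theta> e" unfolding \<theta>_def using e p d by (intro divide_nonneg_pos) auto
      have "e / - p \<le> \<sigma> - s0" using e p by (simp add: e0_def field_simps)
      then show "\<theta> e \<le> 1" using d unfolding \<theta>_def by (subst divide_le_eq_1) auto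
      have "\<theta> e * (\<sigma> - s0) = e / - p" using d by (simp add: \<theta>_def)
      then show "(1 - \<theta> e) * \<sigma> + \<theta> e * s0 = \<sigma> + e / p" by (simp add: algebra_simps)
    qed
    have ep: "\<sigma> + e / p > \<gamma>"
    proof -
      have "e / - p < \<sigma> - s0" using e p by (simp add: e0_def field_simps)
      moreover have "s0 > \<gamma>" using \<sigma> by (simp add: s0_def)
      moreover have "e / p = - (e / - p)" by simp
      ultimately show ?thesis by linarith
    qed
    define s where "s = enn2real (test_sum e)"
    have s: "test_sum e = ennreal s" using test_sum_finite[OF e(1)] by (simp add: s_def)
    have s_ge: "V0 powr - e / e \<le> s"
      using test_sum_ge[OF e(1)] unfolding s by (subst (asm) ennreal_le_iff) (auto simp: s_def V0_def)
    have s_pos: "s > 0" using s_ge V0 e by (smt (verit) divide_pos_pos powr_gt_zero)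
    define N where "N = 1 / e - 1 / p"
    have N: "N > 0" 
    proof -
      have "1 / e > 0" "1 / p < 0" using e p by auto
      then show ?thesis unfolding N_def by linarith
    qed
    have adm: "admissible_f p \<delta> \<sigma> \<mu> (test_f e)" "admissible_a q \<sigma> \<nu> \<nu>t (test_a e)"
      unfolding admissible_f_iff admissible_a_iff mass_test_a
      using mass_test_f[OF e(1)] s s_pos \<mu>_pos \<nu>_pos
      by (auto simp: test_f_def test_a_def less_imp_le intro: le_less_trans)
    have k1: "k (\<sigma> + e / p) \<le> ennreal ((1 - \<theta> e) * \<kappa> + \<theta> e * \<kappa>0)"
      using k_const_convex[OF \<theta>(1,2) \<rho>, of \<alpha> \<gamma> \<sigma> s0] \<theta> \<kappa>_pos reals
      by (simp add: k_eq ennreal_mult' ennreal_plus)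
    have "ennreal C * ennreal (N powr (1 / p)) * ennreal (s powr (1 / q))
        \<le> ennreal C * norm_f p \<delta> \<sigma> \<mu> (test_f e) * norm_a q \<sigma> \<nu> \<nu>t (test_a e)"
    proof (intro mult_mono order_refl)
      show "ennreal (N powr (1 / p)) \<le> norm_f p \<delta> \<sigma> \<mu> (test_f e)"
        unfolding norm_f_mass epowr_ennreal[OF N, symmetric]
        using mass_test_f(2)[OF e(1)] p by (intro epowr_antimono) (auto simp: N_def)
      show "ennreal (s powr (1 / q)) \<le> norm_a q \<sigma> \<nu> \<nu>t (test_a e)"
        using s_pos by (simp add: norm_a_mass mass_test_a s epowr_ennreal)
    qed auto
    also have "\<dots> \<le> (\<Sum>n. \<integral>\<^sup>+x. ennreal (H x (Suc n) * test_a e (Suc n) * test_f e x) \<partial>L)"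
      using double adm unfolding ineq_double_def nn_integral_L by (blast intro: less_imp_le)
    also have "\<dots> \<le> k (\<sigma> + e / p) * test_sum e + k (\<sigma> + 1) * ennreal (w0 powr - (e / q)) * test_sum 1"
      using double_test[OF e(1) ep] by (simp add: w0_def)
    also have "\<dots> \<le> ennreal ((1 - \<theta> e) * \<kappa> + \<theta> e * \<kappa>0) * ennreal s + ennreal \<kappa>2 * ennreal (w0 powr - (e / q)) * ennreal T1"
      unfolding s reals by (intro add_mono mult_right_mono k1) auto
    also have "\<dots> = ennreal (((1 - \<theta> e) * \<kappa> + \<theta> e * \<kappa>0) * s + \<kappa>2 * w0 powr - (e / q) * T1)"
      using \<theta> \<kappa>_pos reals s_pos by (simp add: ennreal_mult' ennreal_plus)
    also have "ennreal C * ennreal (N powr (1 / p)) * ennreal (s powr (1 / q)) = ennreal (C * N powr (1 / p) * s powr (1 / q))"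
      using C_gt \<kappa>_pos by (simp add: ennreal_mult')
    finally have real_le: "C * N powr (1 / p) * s powr (1 / q)
        \<le> ((1 - \<theta> e) * \<kappa> + \<theta> e * \<kappa>0) * s + \<kappa>2 * w0 powr - (e / q) * T1"
      using \<theta> \<kappa>_pos reals s_pos by (subst (asm) ennreal_le_iff) auto
    \<comment> \<open>Since \<open>1/q = 1 - 1/p\<close>, dividing by \<open>s\<close> leaves the power \<open>-1/p\<close> of \<open>s\<close>.\<close>
    have s_split: "s powr (1 / q) = s * s powr - (1 / p)"
    proof -
      have "1 / q = 1 + - (1 / p)" using pq by simp
      then show ?thesis using s_pos by (simp only: powr_add) simp
    qed
    have "s * (C * (N / s) powr (1 / p)) = C * N powr (1 / p) * s powr (1 / q)"
      unfolding s_split using s_pos N by (simp add: powr_divide powr_minus_divide)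
    also note real_le
    also have "((1 - \<theta> e) * \<kappa> + \<theta> e * \<kappa>0) * s + \<kappa>2 * w0 powr - (e / q) * T1
        = s * ((1 - \<theta> e) * \<kappa> + \<theta> e * \<kappa>0 + \<kappa>2 * w0 powr - (e / q) * T1 * (1 / s))"
      using s_pos by (simp add: field_simps)
    finally have "C * (N / s) powr (1 / p) \<le> (1 - \<theta> e) * \<kappa> + \<theta> e * \<kappa>0 + \<kappa>2 * w0 powr - (e / q) * T1 * (1 / s)"
      using s_pos by (simp only: mult_le_cancel_left_pos)
    also have "\<dots> \<le> (1 - \<theta> e) * \<kappa> + \<theta> e * \<kappa>0 + \<kappa>2 * w0 powr - (e / q) * T1 * (e * V0 powr e)"
    proof (intro add_left_mono mult_left_mono)
      have "1 / s \<le> 1 / (V0 powr - e / e)" using s_ge V0 e by (intro frac_le) auto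
      then show "1 / s \<le> e * V0 powr e" by (simp add: powr_minus divide_inverse mult.commute)
    qed (use reals in auto)
    finally have upper: "C * (N / s) powr (1 / p)
        \<le> (1 - \<theta> e) * \<kappa> + \<theta> e * \<kappa>0 + \<kappa>2 * w0 powr - (e / q) * T1 * (e * V0 powr e)" .
    have "N / s \<le> N / (V0 powr - e / e)" using s_ge V0 e N by (intro frac_le) auto
    also have "\<dots> = (1 - e / p) * V0 powr e"
      using e p by (simp add: N_def powr_minus field_simps)
    finally have "((1 - e / p) * V0 powr e) powr (1 / p) \<le> (N / s) powr (1 / p)"
      using N s_pos p by (intro powr_mono2') auto
    then have "C * ((1 - e / p) * V0 powr e) powr (1 / p) \<le> C * (N / s) powr (1 / p)"
      using C_gt \<kappa>_pos by (intro mult_left_mono) auto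
    then show ?thesis using upper by linarith
  qed
  have "C * ((1 - 0 / p) * V0 powr 0) powr (1 / p)
      \<le> (1 - 0 / - p / (\<sigma> - s0)) * \<kappa> + 0 / - p / (\<sigma> - s0) * \<kappa>0 + \<kappa>2 * w0 powr - (0 / q) * T1 * (0 * V0 powr 0)"
  proof (rule tendsto_le)
    show "((\<lambda>e. C * ((1 - e / p) * V0 powr e) powr (1 / p))
        \<longlongrightarrow> C * ((1 - 0 / p) * V0 powr 0) powr (1 / p)) (at_right 0)"
      using p V0 by (intro tendsto_intros) auto
    show "((\<lambda>e. (1 - \<theta> e) * \<kappa> + \<theta> e * \<kappa>0 + \<kappa>2 * w0 powr - (e / q) * T1 * (e * V0 powr e))
        \<longlongrightarrow> (1 - 0 / - p / (\<sigma> - s0)) * \<kappa> + 0 / - p / (\<sigma> - s0) * \<kappa>0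
          + \<kappa>2 * w0 powr - (0 / q) * T1 * (0 * V0 powr 0)) (at_right 0)"
      unfolding \<theta>_def using p V0 w0 q(1) \<sigma> by (intro tendsto_intros) (auto simp: s0_def)
    show "eventually (\<lambda>e. C * ((1 - e / p) * V0 powr e) powr (1 / p)
        \<le> (1 - \<theta> e) * \<kappa> + \<theta> e * \<kappa>0 + \<kappa>2 * w0 powr - (e / q) * T1 * (e * V0 powr e)) (at_right 0)"
      using eventually_at_right_less[of 0] eventually_at_right_field[of _ 0] e0 bound
      unfolding eventually_at_right_field by blast
  qed simp
  then show False using C_gt V0 by simp
qed

end

section \<open>Equivalence and optimality\<close>

lemma ineq_antimono:
  assumes "C \<le> C'"
  shows "ineq_double \<alpha> \<rho> \<gamma> \<sigma> \<delta> p q \<mu> \<nu> \<nu>t C' \<Longrightarrow> ineq_double \<alpha> \<rho> \<gamma> \<sigma> \<delta> p q \<mu> \<nu> \<nu>t C"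
    and "ineq_series \<alpha> \<rho> \<gamma> \<sigma> \<delta> p \<mu> \<nu> \<nu>t C' \<Longrightarrow> ineq_series \<alpha> \<rho> \<gamma> \<sigma> \<delta> p \<mu> \<nu> \<nu>t C"
    and "ineq_integral \<alpha> \<rho> \<gamma> \<sigma> \<delta> q \<mu> \<nu> \<nu>t C' \<Longrightarrow> ineq_integral \<alpha> \<rho> \<gamma> \<sigma> \<delta> q \<mu> \<nu> \<nu>t C"
  unfolding ineq_double_def ineq_series_def ineq_integral_def
  using assms by (meson le_less_trans mult_right_mono zero_le)+

theorem theorem3:
  fixes \<alpha> \<rho> \<gamma> \<sigma> \<delta> p q :: real
    and \<mu> :: "real \<Rightarrow> real" and \<nu> \<nu>t :: "nat \<Rightarrow> real"
  assumes "0 \<le> \<alpha>" "\<alpha> \<le> \<rho>" "\<rho> > 0"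
    and "0 < \<gamma>" "\<gamma> < \<sigma>" "\<sigma> \<le> 1"
    and "\<delta> \<in> {-1, 1}"
    and "p < 0" "1 / p + 1 / q = 1"
    and "continuous_on {0<..} \<mu>" "\<And>t. t > 0 \<Longrightarrow> \<mu> t > 0"
    and "\<And>x. x > 0 \<Longrightarrow> set_integrable lebesgue {0<..<x} \<mu>"
    and "\<And>n. n \<ge> 1 \<Longrightarrow> \<nu> n > 0"
    and "\<And>n. n \<ge> 1 \<Longrightarrow> \<nu>t n \<in> {0..\<nu> n / 2}"
    and "\<exists>n0\<ge>1. \<forall>n\<ge>n0. \<nu> n \<ge> \<nu> (Suc n)"
    and "U_infty \<mu> = \<infinity>" "V_infty \<nu> = \<infinity>"
  shows
    "ineq_double \<alpha> \<rho> \<gamma> \<sigma> \<delta> p q \<mu> \<nu> \<nu>t (k_const \<alpha> \<rho> \<gamma> \<sigma>) \<and>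
     ineq_series \<alpha> \<rho> \<gamma> \<sigma> \<delta> p \<mu> \<nu> \<nu>t (k_const \<alpha> \<rho> \<gamma> \<sigma>) \<and>
     ineq_integral \<alpha> \<rho> \<gamma> \<sigma> \<delta> q \<mu> \<nu> \<nu>t (k_const \<alpha> \<rho> \<gamma> \<sigma>) \<and>
     (\<forall>C::real.
        (ineq_double \<alpha> \<rho> \<gamma> \<sigma> \<delta> p q \<mu> \<nu> \<nu>t (ennreal C) \<longleftrightarrow>
           ineq_series \<alpha> \<rho> \<gamma> \<sigma> \<delta> p \<mu> \<nu> \<nu>t (ennreal C)) \<and>
        (ineq_double \<alpha> \<rho> \<gamma> \<sigma> \<delta> p q \<mu> \<nu> \<nu>t (ennreal C) \<longleftrightarrow>
           ineq_integral \<alpha> \<rho> \<gamma> \<sigma> \<delta> q \<mu> \<nu> \<nu>t (ennreal C))) \<and>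
     (\<forall>K::real. k_const \<alpha> \<rho> \<gamma> \<sigma> < ennreal K \<longrightarrow>
        \<not> ineq_double \<alpha> \<rho> \<gamma> \<sigma> \<delta> p q \<mu> \<nu> \<nu>t (ennreal K) \<and>
        \<not> ineq_series \<alpha> \<rho> \<gamma> \<sigma> \<delta> p \<mu> \<nu> \<nu>t (ennreal K) \<and>
        \<not> ineq_integral \<alpha> \<rho> \<gamma> \<sigma> \<delta> q \<mu> \<nu> \<nu>t (ennreal K))"
proof -
  obtain n0 where n0: "n0 \<ge> 1" "\<And>n. n \<ge> n0 \<Longrightarrow> \<nu> n \<ge> \<nu> (Suc n)" using assms(15) by blast
  interpret half_discrete_divergent \<alpha> \<rho> \<gamma> \<sigma> \<delta> p q \<mu> \<nu> \<nu>t n0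
    by unfold_locales (use assms n0 in auto)
  note holds = double_of_series[OF ineq_series_k] ineq_series_k ineq_integral_k
  have fails: "\<not> ineq_double \<alpha> \<rho> \<gamma> \<sigma> \<delta> p q \<mu> \<nu> \<nu>t (ennreal C) \<and>
      \<not> ineq_series \<alpha> \<rho> \<gamma> \<sigma> \<delta> p \<mu> \<nu> \<nu>t (ennreal C) \<and>
      \<not> ineq_integral \<alpha> \<rho> \<gamma> \<sigma> \<delta> q \<mu> \<nu> \<nu>t (ennreal C)"
    if "k_const \<alpha> \<rho> \<gamma> \<sigma> < ennreal C" for C
    using not_ineq_double[OF that] double_of_series double_of_integral by blast
  have "(ineq_double \<alpha> \<rho> \<gamma> \<sigma> \<delta> p q \<mu> \<nu> \<nu>t (ennreal C) \<longleftrightarrow>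
           ineq_series \<alpha> \<rho> \<gamma> \<sigma> \<delta> p \<mu> \<nu> \<nu>t (ennreal C)) \<and>
        (ineq_double \<alpha> \<rho> \<gamma> \<sigma> \<delta> p q \<mu> \<nu> \<nu>t (ennreal C) \<longleftrightarrow>
           ineq_integral \<alpha> \<rho> \<gamma> \<sigma> \<delta> q \<mu> \<nu> \<nu>t (ennreal C))" for C
  proof (cases "ennreal C \<le> k_const \<alpha> \<rho> \<gamma> \<sigma>")
    case True
    show ?thesis
      using ineq_antimono(1)[OF True holds(1)] ineq_antimono(2)[OF True holds(2)]
        ineq_antimono(3)[OF True holds(3)] by simp
  next
    case False
    then show ?thesis using fails[of C] by (simp add: not_le)
  qed
  then show ?thesis using holds fails by blast
qed

end
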